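(* Let $\mathcal A$ be a locally small abelian category with enough projectives. The following conditions are equivalent. (1) The category $\mathcal A$ is weakly Gorenstein. (2) Every object of ${}^{\perp}\mathcal P(\mathcal A)$ is infinitely torsionfree. (3) For some $n\ge1$, every object of ${}^{\perp}\mathcal P(\mathcal A)$ is $n$-torsionfree. (4) Every object of ${}^{\perp}\mathcal P(\mathcal A)$ is $1$-torsionfree.
   Context: $\mathcal P(\mathcal A)$ is the full subcategory of projectives and ${}^{\perp}\mathcal P(\mathcal A)=\{X\in\mathcal A\mid \mathrm{Ext}^i_{\mathcal A}(X,P)=0\text{ for all }i\ge1,\ P\in\mathcal P(\mathcal A)\}$. A morphism $f:M\to P$ with $P$ projective is a left projective approximation if every morphism from $M$ to a projective object factors through $f$. For $n\ge1$, $M$ is $n$-torsionfree if there is an exact sequence $0\to M\xrightarrow{f_1}P_1\xrightarrow{f_2}\cdots\xrightarrow{f_n}P_n$ with all $P_i$ projective such that each inclusion $\mathrm{Im} f_i\to P_i$ is a left projective approximation ($1\le i\le n$); $M$ is infinitely torsionfree if it is $n$-torsionfree for all $n\ge1$. An object is Gorenstein projective if it is isomorphic to the zeroth cocycle of a totally acyclic complex, i.e. of an acyclic complex of projectives, unbounded in both directions, that remains acyclic after applying $\mathrm{Hom}_{\mathcal A}(-,P)$ for every projective $P$; $\mathrm{GP}(\mathcal A)$ is the full subcategory of these objects. $\mathcal A$ is weakly Gorenstein if $\mathrm{GP}(\mathcal A)={}^{\perp}\mathcal P(\mathcal A)$. *)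

theory Defs
  imports "HOL-Algebra.Elementary_Groups"
begin

section \<open>Abelian categories\<close>

text \<open>
  Objects and morphisms are sets over arbitrary types; composition \<open>g \<cdot> f\<close> is written in the
  applicative order (first \<open>f\<close>, then \<open>g\<close>). The sum \<open>Add\<close> and the zeros \<open>Zero\<close> are the enrichment
  in abelian groups.  Each \<open>Hom A X Y\<close> is a set, so local smallness is built in.
\<close>

record ('o, 'm) ab_category =
  Obj :: "'o set"
  Mor :: "'m set"
  Dom :: "'m \<Rightarrow> 'o"
  Cod :: "'m \<Rightarrow> 'o"
  Id :: "'o \<Rightarrow> 'm"
  Comp :: "'m \<Rightarrow> 'm \<Rightarrow> 'm" (infixl \<open>\<cdot>\<index>\<close> 70)
  Add :: "'m \<Rightarrow> 'm \<Rightarrow> 'm"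
  Zero :: "'o \<Rightarrow> 'o \<Rightarrow> 'm"

definition Hom :: "('o, 'm, 'x) ab_category_scheme \<Rightarrow> 'o \<Rightarrow> 'o \<Rightarrow> 'm set" where
  "Hom A X Y = {f \<in> Mor A. Dom A f = X \<and> Cod A f = Y}"

text \<open>The group of morphisms, written in the (multiplicative) group records of HOL-Algebra.\<close>

definition hom_group :: "('o, 'm, 'x) ab_category_scheme \<Rightarrow> 'o \<Rightarrow> 'o \<Rightarrow> 'm monoid" where
  "hom_group A X Y = \<lparr>carrier = Hom A X Y, mult = Add A, one = Zero A X Y\<rparr>"

locale category =
  fixes A (structure)
  assumes Dom_Obj: "f \<in> Mor A \<Longrightarrow> Dom A f \<in> Obj A"
    and Cod_Obj: "f \<in> Mor A \<Longrightarrow> Cod A f \<in> Obj A"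
    and Id_Hom: "X \<in> Obj A \<Longrightarrow> Id A X \<in> Hom A X X"
    and Comp_Hom: "f \<in> Hom A X Y \<Longrightarrow> g \<in> Hom A Y Z \<Longrightarrow> g \<cdot> f \<in> Hom A X Z"
    and Id_left: "f \<in> Hom A X Y \<Longrightarrow> Id A Y \<cdot> f = f"
    and Id_right: "f \<in> Hom A X Y \<Longrightarrow> f \<cdot> Id A X = f"
    and Comp_assoc: "f \<in> Hom A W X \<Longrightarrow> g \<in> Hom A X Y \<Longrightarrow> h \<in> Hom A Y Z \<Longrightarrow>
      (h \<cdot> g) \<cdot> f = h \<cdot> (g \<cdot> f)"

locale preadditive_category = category +
  assumes hom_comm_group: "X \<in> Obj A \<Longrightarrow> Y \<in> Obj A \<Longrightarrow> comm_group (hom_group A X Y)"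
    and Comp_Add_left: "f \<in> Hom A X Y \<Longrightarrow> g \<in> Hom A Y Z \<Longrightarrow> g' \<in> Hom A Y Z \<Longrightarrow>
      Add A g g' \<cdot> f = Add A (g \<cdot> f) (g' \<cdot> f)"
    and Comp_Add_right: "f \<in> Hom A X Y \<Longrightarrow> f' \<in> Hom A X Y \<Longrightarrow> g \<in> Hom A Y Z \<Longrightarrow>
      g \<cdot> Add A f f' = Add A (g \<cdot> f) (g \<cdot> f')"

definition zero_object :: "('o, 'm, 'x) ab_category_scheme \<Rightarrow> 'o \<Rightarrow> bool" where
  "zero_object A Z \<longleftrightarrow> Z \<in> Obj A \<and>
    (\<forall>X\<in>Obj A. (\<exists>!f. f \<in> Hom A X Z) \<and> (\<exists>!f. f \<in> Hom A Z X))"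

definition biproduct :: "('o, 'm, 'x) ab_category_scheme \<Rightarrow> 'o \<Rightarrow> 'o \<Rightarrow> 'o \<Rightarrow> bool" where
  "biproduct A X Y W \<longleftrightarrow> W \<in> Obj A \<and>
    (\<exists>i\<in>Hom A X W. \<exists>j\<in>Hom A Y W. \<exists>p\<in>Hom A W X. \<exists>q\<in>Hom A W Y.
      p \<cdot>\<^bsub>A\<^esub> i = Id A X \<and> q \<cdot>\<^bsub>A\<^esub> j = Id A Y \<and>
      q \<cdot>\<^bsub>A\<^esub> i = Zero A X Y \<and> p \<cdot>\<^bsub>A\<^esub> j = Zero A Y X \<and>
      Add A (i \<cdot>\<^bsub>A\<^esub> p) (j \<cdot>\<^bsub>A\<^esub> q) = Id A W)"

definition mono_mor :: "('o, 'm, 'x) ab_category_scheme \<Rightarrow> 'm \<Rightarrow> bool" where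
  "mono_mor A f \<longleftrightarrow> f \<in> Mor A \<and>
    (\<forall>X. \<forall>u\<in>Hom A X (Dom A f). \<forall>v\<in>Hom A X (Dom A f). f \<cdot>\<^bsub>A\<^esub> u = f \<cdot>\<^bsub>A\<^esub> v \<longrightarrow> u = v)"

definition epi_mor :: "('o, 'm, 'x) ab_category_scheme \<Rightarrow> 'm \<Rightarrow> bool" where
  "epi_mor A f \<longleftrightarrow> f \<in> Mor A \<and>
    (\<forall>Y. \<forall>u\<in>Hom A (Cod A f) Y. \<forall>v\<in>Hom A (Cod A f) Y. u \<cdot>\<^bsub>A\<^esub> f = v \<cdot>\<^bsub>A\<^esub> f \<longrightarrow> u = v)"

definition is_kernel :: "('o, 'm, 'x) ab_category_scheme \<Rightarrow> 'm \<Rightarrow> 'm \<Rightarrow> bool" where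
  "is_kernel A k f \<longleftrightarrow> f \<in> Mor A \<and> k \<in> Mor A \<and> Cod A k = Dom A f \<and>
    f \<cdot>\<^bsub>A\<^esub> k = Zero A (Dom A k) (Cod A f) \<and>
    (\<forall>X. \<forall>h\<in>Hom A X (Dom A f). f \<cdot>\<^bsub>A\<^esub> h = Zero A X (Cod A f) \<longrightarrow>
      (\<exists>!u. u \<in> Hom A X (Dom A k) \<and> k \<cdot>\<^bsub>A\<^esub> u = h))"

definition is_cokernel :: "('o, 'm, 'x) ab_category_scheme \<Rightarrow> 'm \<Rightarrow> 'm \<Rightarrow> bool" where
  "is_cokernel A c f \<longleftrightarrow> f \<in> Mor A \<and> c \<in> Mor A \<and> Dom A c = Cod A f \<and>
    c \<cdot>\<^bsub>A\<^esub> f = Zero A (Dom A f) (Cod A c) \<and>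
    (\<forall>Y. \<forall>h\<in>Hom A (Cod A f) Y. h \<cdot>\<^bsub>A\<^esub> f = Zero A (Dom A f) Y \<longrightarrow>
      (\<exists>!u. u \<in> Hom A (Cod A c) Y \<and> u \<cdot>\<^bsub>A\<^esub> c = h))"

locale abelian_category = preadditive_category +
  assumes ex_zero_object: "\<exists>Z. zero_object A Z"
    and ex_biproduct: "X \<in> Obj A \<Longrightarrow> Y \<in> Obj A \<Longrightarrow> \<exists>W. biproduct A X Y W"
    and ex_kernel: "f \<in> Mor A \<Longrightarrow> \<exists>k. is_kernel A k f"
    and ex_cokernel: "f \<in> Mor A \<Longrightarrow> \<exists>c. is_cokernel A c f"
    and mono_normal: "mono_mor A f \<Longrightarrow> \<exists>g. is_kernel A f g"
    and epi_normal: "epi_mor A f \<Longrightarrow> \<exists>g. is_cokernel A f g"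

definition isomorphic :: "('o, 'm, 'x) ab_category_scheme \<Rightarrow> 'o \<Rightarrow> 'o \<Rightarrow> bool" where
  "isomorphic A X Y \<longleftrightarrow> X \<in> Obj A \<and> Y \<in> Obj A \<and>
    (\<exists>f\<in>Hom A X Y. \<exists>g\<in>Hom A Y X. g \<cdot>\<^bsub>A\<^esub> f = Id A X \<and> f \<cdot>\<^bsub>A\<^esub> g = Id A Y)"

text \<open>
  \<open>is_image A m f\<close>: the morphism \<open>m\<close> is an inclusion of \<open>Im f = Ker (Coker f)\<close> into the codomain
  of \<open>f\<close>.
\<close>

definition is_image :: "('o, 'm, 'x) ab_category_scheme \<Rightarrow> 'm \<Rightarrow> 'm \<Rightarrow> bool" where
  "is_image A m f \<longleftrightarrow> (\<exists>c. is_cokernel A c f \<and> is_kernel A m c)"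

text \<open>Exactness of \<open>\<bullet> \<rightarrow> \<bullet> \<rightarrow> \<bullet>\<close> (first \<open>f\<close>, then \<open>g\<close>) at the middle object: \<open>Im f = Ker g\<close>.\<close>

definition exact_pair :: "('o, 'm, 'x) ab_category_scheme \<Rightarrow> 'm \<Rightarrow> 'm \<Rightarrow> bool" where
  "exact_pair A f g \<longleftrightarrow> f \<in> Mor A \<and> g \<in> Mor A \<and> Cod A f = Dom A g \<and>
    (\<exists>m. is_image A m f \<and> is_kernel A m g)"


section \<open>Projective objects and extension groups\<close>

definition projective :: "('o, 'm, 'x) ab_category_scheme \<Rightarrow> 'o \<Rightarrow> bool" where
  "projective A P \<longleftrightarrow> P \<in> Obj A \<and>
    (\<forall>e. epi_mor A e \<longrightarrow> (\<forall>f\<in>Hom A P (Cod A e). \<exists>g\<in>Hom A P (Dom A e). e \<cdot>\<^bsub>A\<^esub> g = f))"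

definition enough_projectives :: "('o, 'm, 'x) ab_category_scheme \<Rightarrow> bool" where
  "enough_projectives A \<longleftrightarrow>
    (\<forall>X\<in>Obj A. \<exists>P. projective A P \<and> (\<exists>e\<in>Hom A P X. epi_mor A e))"

text \<open>
  A projective resolution \<open>\<cdots> \<rightarrow> P 2 \<rightarrow> P 1 \<rightarrow> P 0 \<rightarrow> X \<rightarrow> 0\<close>, with \<open>d n : P (n + 1) \<rightarrow> P n\<close> and
  augmentation \<open>e : P 0 \<rightarrow> X\<close>.
\<close>

definition projective_resolution ::
    "('o, 'm, 'x) ab_category_scheme \<Rightarrow> 'o \<Rightarrow> (nat \<Rightarrow> 'o) \<Rightarrow> (nat \<Rightarrow> 'm) \<Rightarrow> 'm \<Rightarrow> bool" where
  "projective_resolution A X P d e \<longleftrightarrow>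
    (\<forall>n. projective A (P n)) \<and> e \<in> Hom A (P 0) X \<and> (\<forall>n. d n \<in> Hom A (P (Suc n)) (P n)) \<and>
    epi_mor A e \<and> exact_pair A (d 0) e \<and> (\<forall>n. exact_pair A (d (Suc n)) (d n))"

text \<open>The map \<open>Hom(f, Y) : Hom(Cod f, Y) \<rightarrow> Hom(Dom f, Y)\<close>.\<close>

definition precomp :: "('o, 'm, 'x) ab_category_scheme \<Rightarrow> 'm \<Rightarrow> 'm \<Rightarrow> 'm" where
  "precomp A f = (\<lambda>g. g \<cdot>\<^bsub>A\<^esub> f)"

definition ext_cocycles ::
    "('o, 'm, 'x) ab_category_scheme \<Rightarrow> (nat \<Rightarrow> 'o) \<Rightarrow> (nat \<Rightarrow> 'm) \<Rightarrow> nat \<Rightarrow> 'o \<Rightarrow> 'm set" where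
  "ext_cocycles A P d i Y = kernel (hom_group A (P i) Y) (hom_group A (P (Suc i)) Y) (precomp A (d i))"

fun ext_coboundaries ::
    "('o, 'm, 'x) ab_category_scheme \<Rightarrow> (nat \<Rightarrow> 'o) \<Rightarrow> (nat \<Rightarrow> 'm) \<Rightarrow> nat \<Rightarrow> 'o \<Rightarrow> 'm set" where
  "ext_coboundaries A P d 0 Y = {Zero A (P 0) Y}"
| "ext_coboundaries A P d (Suc i) Y = precomp A (d i) ` carrier (hom_group A (P i) Y)"

definition ext_of_resolution ::
    "('o, 'm, 'x) ab_category_scheme \<Rightarrow> (nat \<Rightarrow> 'o) \<Rightarrow> (nat \<Rightarrow> 'm) \<Rightarrow> nat \<Rightarrow> 'o \<Rightarrow> 'm set monoid" where
  "ext_of_resolution A P d i Y =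
    (hom_group A (P i) Y)\<lparr>carrier := ext_cocycles A P d i Y\<rparr> Mod ext_coboundaries A P d i Y"

text \<open>
  \<open>Ext A i X Y\<close> is the \<open>i\<close>-th right derived functor of \<open>Hom(-, Y)\<close> at \<open>X\<close>, i.e. the cohomology of
  \<open>Hom(P, Y)\<close> for a projective resolution \<open>P\<close> of \<open>X\<close>. The resolution is chosen once and for all for
  each \<open>X\<close>; one exists if there are enough projectives, and a different choice gives isomorphic groups.
\<close>

definition chosen_resolution ::
    "('o, 'm, 'x) ab_category_scheme \<Rightarrow> 'o \<Rightarrow> (nat \<Rightarrow> 'o) \<times> (nat \<Rightarrow> 'm)" where
  "chosen_resolution A X = (SOME (P, d). \<exists>e. projective_resolution A X P d e)"

definition Ext :: "('o, 'm, 'x) ab_category_scheme \<Rightarrow> nat \<Rightarrow> 'o \<Rightarrow> 'o \<Rightarrow> 'm set monoid" where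
  "Ext A i X Y = (case chosen_resolution A X of (P, d) \<Rightarrow> ext_of_resolution A P d i Y)"

definition perp_proj :: "('o, 'm, 'x) ab_category_scheme \<Rightarrow> 'o set" where
  "perp_proj A = {X \<in> Obj A. \<forall>i\<ge>1. \<forall>P. projective A P \<longrightarrow> trivial_group (Ext A i X P)}"


section \<open>Torsionfree and Gorenstein projective objects\<close>

definition left_proj_approx :: "('o, 'm, 'x) ab_category_scheme \<Rightarrow> 'm \<Rightarrow> bool" where
  "left_proj_approx A f \<longleftrightarrow> f \<in> Mor A \<and> projective A (Cod A f) \<and>
    (\<forall>Q. projective A Q \<longrightarrow> (\<forall>h\<in>Hom A (Dom A f) Q. \<exists>g\<in>Hom A (Cod A f) Q. h = g \<cdot>\<^bsub>A\<^esub> f))"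

text \<open>
  The exact sequence is \<open>0 \<rightarrow> M \<rightarrow> P 1 \<rightarrow> \<cdots> \<rightarrow> P n\<close>, where \<open>f 1 : M \<rightarrow> P 1\<close> and
  \<open>f (i + 1) : P i \<rightarrow> P (i + 1)\<close>. The notion is meant for \<open>n \<ge> 1\<close>; there is no exactness condition
  at \<open>P n\<close>.
\<close>

definition torsionfree :: "('o, 'm, 'x) ab_category_scheme \<Rightarrow> nat \<Rightarrow> 'o \<Rightarrow> bool" where
  "torsionfree A n M \<longleftrightarrow> (\<exists>P f.
    (\<forall>i\<in>{1..n}. projective A (P i)) \<and>
    f 1 \<in> Hom A M (P 1) \<and> (\<forall>i\<in>{1..<n}. f (Suc i) \<in> Hom A (P i) (P (Suc i))) \<and>
    mono_mor A (f 1) \<and> (\<forall>i\<in>{1..<n}. exact_pair A (f i) (f (Suc i))) \<and>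
    (\<forall>i\<in>{1..n}. \<exists>m. is_image A m (f i) \<and> left_proj_approx A m))"

definition infinitely_torsionfree :: "('o, 'm, 'x) ab_category_scheme \<Rightarrow> 'o \<Rightarrow> bool" where
  "infinitely_torsionfree A M \<longleftrightarrow> (\<forall>n\<ge>1. torsionfree A n M)"

text \<open>
  Cochain complexes \<open>\<cdots> \<rightarrow> P i \<rightarrow> P (i + 1) \<rightarrow> \<cdots>\<close> with \<open>d i : P i \<rightarrow> P (i + 1)\<close> for all integers \<open>i\<close>.
  That consecutive differentials compose to zero is part of exactness.
\<close>

definition acyclic_complex ::
    "('o, 'm, 'x) ab_category_scheme \<Rightarrow> (int \<Rightarrow> 'o) \<Rightarrow> (int \<Rightarrow> 'm) \<Rightarrow> bool" where
  "acyclic_complex A P d \<longleftrightarrow>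
    (\<forall>i. d i \<in> Hom A (P i) (P (i + 1))) \<and> (\<forall>i. exact_pair A (d i) (d (i + 1)))"

definition totally_acyclic ::
    "('o, 'm, 'x) ab_category_scheme \<Rightarrow> (int \<Rightarrow> 'o) \<Rightarrow> (int \<Rightarrow> 'm) \<Rightarrow> bool" where
  "totally_acyclic A P d \<longleftrightarrow> (\<forall>i. projective A (P i)) \<and> acyclic_complex A P d \<and>
    (\<forall>Q. projective A Q \<longrightarrow> (\<forall>i.
      kernel (hom_group A (P (i + 1)) Q) (hom_group A (P i) Q) (precomp A (d i)) =
      precomp A (d (i + 1)) ` carrier (hom_group A (P (i + 2)) Q)))"

definition GP :: "('o, 'm, 'x) ab_category_scheme \<Rightarrow> 'o set" where
  "GP A = {X. \<exists>P d k. totally_acyclic A P d \<and> is_kernel A k (d 0) \<and> isomorphic A X (Dom A k)}"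

text \<open>Both sides are full subcategories, hence are compared through their classes of objects.\<close>

definition weakly_Gorenstein :: "('o, 'm, 'x) ab_category_scheme \<Rightarrow> bool" where
  "weakly_Gorenstein A \<longleftrightarrow> GP A = perp_proj A"

end

theory Submission
  imports Defs
begin

text \<open>
  Call a short exact sequence \<open>0 \<rightarrow> K \<rightarrow> P \<rightarrow> M \<rightarrow> 0\<close> with \<open>P\<close> projective good if \<open>K \<rightarrow> P\<close> is a left
  projective approximation, i.e. if the first extension groups of \<open>M\<close> with values in projectives
  vanish. By dimension shifting, \<open>M\<close> lies in the left orthogonal class of the projectives iff it is
  the end of an infinite chain of good sequences going down through its syzygies, and then every
  such chain is good. Likewise, \<open>M\<close> is Gorenstein projective iff it is a term of a chain of good
  sequences unbounded in both directions. A 1-torsionfree object of the orthogonal class is the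
  kernel of a good sequence whose cokernel is again in the class, so if all objects of the class are
  1-torsionfree, the downward chain can be continued upwards indefinitely.
\<close>

section \<open>Preliminaries on abelian categories\<close>

context preadditive_category
begin

section \<open>Groups of morphisms and bilinearity of composition\<close>

lemma Hom_Mor: "f \<in> Hom A X Y \<Longrightarrow> f \<in> Mor A"
  and Hom_Dom: "f \<in> Hom A X Y \<Longrightarrow> Dom A f = X"
  and Hom_Cod: "f \<in> Hom A X Y \<Longrightarrow> Cod A f = Y"
  by (simp_all add: Hom_def)

lemma Hom_Obj:
  assumes "f \<in> Hom A X Y"
  shows "X \<in> Obj A" "Y \<in> Obj A"
  using assms Dom_Obj Cod_Obj by (auto simp: Hom_def)

lemma hom_group_simps [simp]:
  "carrier (hom_group A X Y) = Hom A X Y"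
  "mult (hom_group A X Y) = Add A"
  "one (hom_group A X Y) = Zero A X Y"
  by (simp_all add: hom_group_def)

lemma Zero_Hom:
  assumes "X \<in> Obj A" "Y \<in> Obj A"
  shows "Zero A X Y \<in> Hom A X Y"
proof -
  interpret G: comm_group "hom_group A X Y"
    using hom_comm_group assms by blast
  show ?thesis using G.one_closed by simp
qed

lemma Add_Hom:
  assumes "f \<in> Hom A X Y" "g \<in> Hom A X Y"
  shows "Add A f g \<in> Hom A X Y"
proof -
  interpret G: comm_group "hom_group A X Y"
    using hom_comm_group Hom_Obj[OF assms(1)] by blast
  show ?thesis using G.m_closed assms by simp
qed

lemma Add_Zero:
  assumes "f \<in> Hom A X Y"
  shows "Add A f (Zero A X Y) = f" "Add A (Zero A X Y) f = f"
proof -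
  interpret G: comm_group "hom_group A X Y"
    using hom_comm_group Hom_Obj[OF assms(1)] by blast
  show "Add A f (Zero A X Y) = f" "Add A (Zero A X Y) f = f"
    using G.r_one G.l_one assms by simp_all
qed

lemma Add_commute:
  assumes "f \<in> Hom A X Y" "g \<in> Hom A X Y"
  shows "Add A f g = Add A g f"
proof -
  interpret G: comm_group "hom_group A X Y"
    using hom_comm_group Hom_Obj[OF assms(1)] by blast
  show ?thesis using G.m_comm assms by simp
qed

lemma Add_cancel:
  assumes "f \<in> Hom A X Y" "g \<in> Hom A X Y" "h \<in> Hom A X Y" "Add A f g = Add A f h"
  shows "g = h"
proof -
  interpret G: comm_group "hom_group A X Y"
    using hom_comm_group Hom_Obj[OF assms(1)] by blast
  show ?thesis using G.Units_l_cancel[of f g h] assms by simp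
qed

text \<open>Serves as subtraction: the record carries only \<open>Add\<close> and
  \<open>Zero\<close>, so the inverse is taken in \<open>hom_group\<close> and differences are
  supplied existentially.\<close>

lemma ex_difference:
  assumes "f \<in> Hom A X Y" "g \<in> Hom A X Y"
  obtains h where "h \<in> Hom A X Y" "f = Add A g h"
proof -
  interpret G: comm_group "hom_group A X Y"
    using hom_comm_group Hom_Obj[OF assms(1)] by blast
  let ?h = "mult (hom_group A X Y) (m_inv (hom_group A X Y) g) f"
  have "?h \<in> carrier (hom_group A X Y)"
    using assms by (intro G.m_closed G.inv_closed) simp_all
  moreover have "mult (hom_group A X Y) g ?h = f"
    using assms G.m_assoc[of g "m_inv (hom_group A X Y) g" f] G.inv_closed[of g] G.r_inv[of g]
      G.l_one[of f]
    by (simp del: hom_group_simps(2,3))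
  ultimately show thesis using that by simp
qed

text \<open>By distributivity the composite added to itself is itself, and in a group only the
  neutral element has this property.\<close>

lemma Comp_Zero:
  assumes "f \<in> Hom A X Y" "Z \<in> Obj A"
  shows "f \<cdot> Zero A Z X = Zero A Z Y" "Zero A Y Z \<cdot> f = Zero A X Z"
proof -
  note obj = Hom_Obj[OF assms(1)]
  note zero = Zero_Hom[OF assms(2) obj(1)] Zero_Hom[OF obj(2) assms(2)]
  have "Add A (f \<cdot> Zero A Z X) (f \<cdot> Zero A Z X) = f \<cdot> Zero A Z X"
    using Comp_Add_right[OF zero(1) zero(1) assms(1)] Add_Zero[OF zero(1)] by simp
  then show "f \<cdot> Zero A Z X = Zero A Z Y"
    using Comp_Hom[OF zero(1) assms(1)] Add_cancel Add_Zero Zero_Hom[OF assms(2) obj(2)] by metis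
  have "Add A (Zero A Y Z \<cdot> f) (Zero A Y Z \<cdot> f) = Zero A Y Z \<cdot> f"
    using Comp_Add_left[OF assms(1) zero(2) zero(2)] Add_Zero[OF zero(2)] by simp
  then show "Zero A Y Z \<cdot> f = Zero A X Z"
    using Comp_Hom[OF assms(1) zero(2)] Add_cancel Add_Zero Zero_Hom[OF obj(1) assms(2)] by metis
qed

section \<open>Monomorphisms, epimorphisms, kernels and cokernels\<close>

lemma mono_iff_trivial_kernel:
  assumes "f \<in> Hom A X Y"
  shows "mono_mor A f \<longleftrightarrow> (\<forall>W. \<forall>u\<in>Hom A W X. f \<cdot> u = Zero A W Y \<longrightarrow> u = Zero A W X)"
proof
  assume mono: "mono_mor A f"
  show "\<forall>W. \<forall>u\<in>Hom A W X. f \<cdot> u = Zero A W Y \<longrightarrow> u = Zero A W X"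
  proof (intro allI ballI impI)
    fix W u assume u: "u \<in> Hom A W X" "f \<cdot> u = Zero A W Y"
    then have "f \<cdot> u = f \<cdot> Zero A W X" and "Zero A W X \<in> Hom A W X"
      using Comp_Zero[OF assms] Zero_Hom Hom_Obj[OF u(1)] by auto
    then show "u = Zero A W X"
      using mono u(1) Hom_Dom[OF assms] by (auto simp: mono_mor_def)
  qed
next
  assume triv: "\<forall>W. \<forall>u\<in>Hom A W X. f \<cdot> u = Zero A W Y \<longrightarrow> u = Zero A W X"
  show "mono_mor A f"
    unfolding mono_mor_def Hom_Dom[OF assms]
  proof (intro conjI Hom_Mor[OF assms] allI ballI impI)
    fix W u v assume uv: "u \<in> Hom A W X" "v \<in> Hom A W X" "f \<cdot> u = f \<cdot> v"
    \<comment> \<open>\<open>w\<close> is the difference of \<open>u\<close> and \<open>v\<close>;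
      since \<open>f\<close> identifies these two, it kills \<open>w\<close>.\<close>
    obtain w where w: "w \<in> Hom A W X" "u = Add A v w" using ex_difference uv by blast
    have fv: "f \<cdot> v \<in> Hom A W Y" "f \<cdot> w \<in> Hom A W Y" using Comp_Hom assms uv w by blast+
    have "Add A (f \<cdot> v) (f \<cdot> w) = Add A (f \<cdot> v) (Zero A W Y)"
      using Comp_Add_right[OF uv(2) w(1) assms] uv(3) w(2) Add_Zero(1)[OF fv(1)] by simp
    then have "f \<cdot> w = Zero A W Y"
      using Add_cancel[OF fv] Zero_Hom Hom_Obj[OF fv(1)] by simp
    then show "u = v" using triv w Add_Zero(1)[OF uv(2)] by metis
  qed
qed

lemma epi_iff_trivial_cokernel:
  assumes "f \<in> Hom A X Y"
  shows "epi_mor A f \<longleftrightarrow> (\<forall>W. \<forall>u\<in>Hom A Y W. u \<cdot> f = Zero A X W \<longrightarrow> u = Zero A Y W)"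
proof
  assume epi: "epi_mor A f"
  show "\<forall>W. \<forall>u\<in>Hom A Y W. u \<cdot> f = Zero A X W \<longrightarrow> u = Zero A Y W"
  proof (intro allI ballI impI)
    fix W u assume u: "u \<in> Hom A Y W" "u \<cdot> f = Zero A X W"
    then have "u \<cdot> f = Zero A Y W \<cdot> f" and "Zero A Y W \<in> Hom A Y W"
      using Comp_Zero[OF assms] Zero_Hom Hom_Obj[OF u(1)] by auto
    then show "u = Zero A Y W"
      using epi u(1) Hom_Cod[OF assms] by (auto simp: epi_mor_def)
  qed
next
  assume triv: "\<forall>W. \<forall>u\<in>Hom A Y W. u \<cdot> f = Zero A X W \<longrightarrow> u = Zero A Y W"
  show "epi_mor A f"
    unfolding epi_mor_def Hom_Cod[OF assms]
  proof (intro conjI Hom_Mor[OF assms] allI ballI impI)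
    fix W u v assume uv: "u \<in> Hom A Y W" "v \<in> Hom A Y W" "u \<cdot> f = v \<cdot> f"
    obtain w where w: "w \<in> Hom A Y W" "u = Add A v w" using ex_difference uv by blast
    have fv: "v \<cdot> f \<in> Hom A X W" "w \<cdot> f \<in> Hom A X W" using Comp_Hom assms uv w by blast+
    have "Add A (v \<cdot> f) (w \<cdot> f) = Add A (v \<cdot> f) (Zero A X W)"
      using Comp_Add_left[OF assms uv(2) w(1)] uv(3) w(2) Add_Zero(1)[OF fv(1)] by simp
    then have "w \<cdot> f = Zero A X W"
      using Add_cancel[OF fv] Zero_Hom Hom_Obj[OF fv(1)] by simp
    then show "u = v" using triv w Add_Zero(1)[OF uv(2)] by metis
  qed
qed

lemma mono_cancel:
  assumes "mono_mor A f" "f \<in> Hom A X Y" "u \<in> Hom A W X" "v \<in> Hom A W X" "f \<cdot> u = f \<cdot> v"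
  shows "u = v"
  using assms Hom_Dom[OF assms(2)] by (auto simp: mono_mor_def)

lemma epi_cancel:
  assumes "epi_mor A f" "f \<in> Hom A X Y" "u \<in> Hom A Y W" "v \<in> Hom A Y W" "u \<cdot> f = v \<cdot> f"
  shows "u = v"
  using assms Hom_Cod[OF assms(2)] by (auto simp: epi_mor_def)

text \<open>The uniqueness half of the universal property amounts to \<open>k\<close> being mono:
  every map of the form \<open>k \<cdot> u\<close> is killed by \<open>f\<close>, so uniqueness
  applies to all maps into \<open>K\<close>.\<close>

lemma is_kernel_iff:
  assumes "f \<in> Hom A X Y" "k \<in> Hom A K X"
  shows "is_kernel A k f \<longleftrightarrow> mono_mor A k \<and> f \<cdot> k = Zero A K Y \<and>
    (\<forall>W. \<forall>h\<in>Hom A W X. f \<cdot> h = Zero A W Y \<longrightarrow> (\<exists>u\<in>Hom A W K. h = k \<cdot> u))" (is "?l \<longleftrightarrow> ?r")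
proof -
  note simps = Hom_Mor[OF assms(1)] Hom_Mor[OF assms(2)] Hom_Dom[OF assms(1)] Hom_Cod[OF assms(1)]
    Hom_Dom[OF assms(2)] Hom_Cod[OF assms(2)]
  show ?thesis
  proof
    assume l: ?l
    have "u = v" if "u \<in> Hom A W K" "v \<in> Hom A W K" "k \<cdot> u = k \<cdot> v" for W u v
    proof -
      have "f \<cdot> (k \<cdot> u) = Zero A W Y"
        using Comp_assoc[OF that(1) assms(2,1)] l Comp_Zero(2)[OF that(1)] Hom_Obj[OF assms(1)]
        by (auto simp: is_kernel_def simps)
      moreover have "k \<cdot> u \<in> Hom A W X" using Comp_Hom that assms by blast
      ultimately show ?thesis using l that by (auto simp: is_kernel_def simps)
    qed
    then have "mono_mor A k" by (auto simp: mono_mor_def simps)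
    with l show ?r by (auto simp: is_kernel_def simps) metis
  next
    assume ?r then show ?l
      by (auto simp: is_kernel_def simps) (metis mono_cancel[OF _ assms(2)])
  qed
qed

lemma is_cokernel_iff:
  assumes "f \<in> Hom A X Y" "c \<in> Hom A Y C"
  shows "is_cokernel A c f \<longleftrightarrow> epi_mor A c \<and> c \<cdot> f = Zero A X C \<and>
    (\<forall>W. \<forall>h\<in>Hom A Y W. h \<cdot> f = Zero A X W \<longrightarrow> (\<exists>u\<in>Hom A C W. h = u \<cdot> c))" (is "?l \<longleftrightarrow> ?r")
proof -
  note simps = Hom_Mor[OF assms(1)] Hom_Mor[OF assms(2)] Hom_Dom[OF assms(1)] Hom_Cod[OF assms(1)]
    Hom_Dom[OF assms(2)] Hom_Cod[OF assms(2)]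
  show ?thesis
  proof
    assume l: ?l
    have "u = v" if "u \<in> Hom A C W" "v \<in> Hom A C W" "u \<cdot> c = v \<cdot> c" for W u v
    proof -
      have "(u \<cdot> c) \<cdot> f = Zero A X W"
        using Comp_assoc[OF assms that(1)] l Comp_Zero(1)[OF that(1)] Hom_Obj[OF assms(1)]
        by (auto simp: is_cokernel_def simps)
      moreover have "u \<cdot> c \<in> Hom A Y W" using Comp_Hom that assms by blast
      ultimately show ?thesis using l that by (auto simp: is_cokernel_def simps)
    qed
    then have "epi_mor A c" by (auto simp: epi_mor_def simps)
    with l show ?r by (auto simp: is_cokernel_def simps) metis
  next
    assume ?r then show ?l
      by (auto simp: is_cokernel_def simps) (metis epi_cancel[OF _ assms(2)])
  qed
qed

lemma is_kernel_Hom: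
  assumes "is_kernel A k f" "f \<in> Hom A X Y"
  shows "k \<in> Hom A (Dom A k) X"
  using assms by (auto simp: is_kernel_def Hom_def)

lemma is_cokernel_Hom:
  assumes "is_cokernel A c f" "f \<in> Hom A X Y"
  shows "c \<in> Hom A Y (Cod A c)"
  using assms by (auto simp: is_cokernel_def Hom_def)

end

section \<open>Short exact sequences\<close>

definition short_exact ::
    "('o, 'm, 'x) ab_category_scheme \<Rightarrow> 'o \<Rightarrow> 'o \<Rightarrow> 'o \<Rightarrow> 'm \<Rightarrow> 'm \<Rightarrow> bool" where
  "short_exact A K P M k e \<longleftrightarrow>
    k \<in> Hom A K P \<and> e \<in> Hom A P M \<and> is_kernel A k e \<and> is_cokernel A e k"

context abelian_category
begin

text \<open>By normality \<open>k\<close> is a kernel of some \<open>g\<close>, and \<open>g\<close>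
  factors through the cokernel \<open>c\<close>. So whatever \<open>c\<close> kills is killed by
  \<open>g\<close> and factors through \<open>k\<close>.\<close>

lemma mono_is_kernel_of_cokernel:
  assumes "mono_mor A k" "k \<in> Hom A K P" "is_cokernel A c k"
  shows "is_kernel A k c"
proof -
  note c = is_cokernel_Hom[OF assms(3,2)]
  note C = assms(3)[unfolded is_cokernel_iff[OF assms(2) c]]
  obtain g where "is_kernel A k g" using mono_normal assms(1) by blast
  moreover from this obtain Y where g: "g \<in> Hom A P Y"
    using Hom_Cod[OF assms(2)] by (auto simp: is_kernel_def Hom_def)
  ultimately have G: "g \<cdot> k = Zero A K Y"
      "\<And>W h. h \<in> Hom A W P \<Longrightarrow> g \<cdot> h = Zero A W Y \<Longrightarrow> \<exists>u\<in>Hom A W K. h = k \<cdot> u"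
    using is_kernel_iff[OF g assms(2)] by auto
  obtain g' where g': "g' \<in> Hom A (Cod A c) Y" "g = g' \<cdot> c" using C g G(1) by blast
  have "\<exists>u\<in>Hom A W K. h = k \<cdot> u" if "h \<in> Hom A W P" "c \<cdot> h = Zero A W (Cod A c)" for W h
    using that G(2) Comp_assoc[OF that(1) c g'(1)] Comp_Zero(1)[OF g'(1)] Hom_Obj[OF that(1)] g'(2)
    by simp
  then show ?thesis using is_kernel_iff[OF c assms(2)] assms(1) C by blast
qed

lemma epi_is_cokernel_of_kernel:
  assumes "epi_mor A e" "e \<in> Hom A P M" "is_kernel A k e"
  shows "is_cokernel A e k"
proof -
  note k = is_kernel_Hom[OF assms(3,2)]
  note K = assms(3)[unfolded is_kernel_iff[OF assms(2) k]]
  obtain g where "is_cokernel A e g" using epi_normal assms(1) by blast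
  moreover from this obtain Y where g: "g \<in> Hom A Y P"
    using Hom_Dom[OF assms(2)] by (auto simp: is_cokernel_def Hom_def)
  ultimately have G: "e \<cdot> g = Zero A Y M"
      "\<And>W h. h \<in> Hom A P W \<Longrightarrow> h \<cdot> g = Zero A Y W \<Longrightarrow> \<exists>u\<in>Hom A M W. h = u \<cdot> e"
    using is_cokernel_iff[OF g assms(2)] by auto
  obtain g' where g': "g' \<in> Hom A Y (Dom A k)" "g = k \<cdot> g'" using K g G(1) by blast
  have "\<exists>u\<in>Hom A M W. h = u \<cdot> e" if "h \<in> Hom A P W" "h \<cdot> k = Zero A (Dom A k) W" for W h
    using that G(2) Comp_assoc[OF g'(1) k that(1)] Comp_Zero(2)[OF g'(1)] Hom_Obj[OF that(1)] g'(2)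
    by simp
  then show ?thesis using is_cokernel_iff[OF k assms(2)] assms(1) K by blast
qed

lemma short_exact_of_epi:
  assumes "epi_mor A e" "e \<in> Hom A P M" "is_kernel A k e"
  shows "short_exact A (Dom A k) P M k e"
  using assms epi_is_cokernel_of_kernel is_kernel_Hom by (auto simp: short_exact_def)

lemma short_exact_of_mono:
  assumes "mono_mor A k" "k \<in> Hom A K P" "is_cokernel A e k"
  shows "short_exact A K P (Cod A e) k e"
  using assms mono_is_kernel_of_cokernel is_cokernel_Hom by (auto simp: short_exact_def)

lemma short_exactD:
  assumes "short_exact A K P M k e"
  shows "k \<in> Hom A K P" "e \<in> Hom A P M" "mono_mor A k" "epi_mor A e" "e \<cdot> k = Zero A K M"
    "\<And>W h. h \<in> Hom A W P \<Longrightarrow> e \<cdot> h = Zero A W M \<Longrightarrow> \<exists>u\<in>Hom A W K. h = k \<cdot> u"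
    "\<And>W h. h \<in> Hom A P W \<Longrightarrow> h \<cdot> k = Zero A K W \<Longrightarrow> \<exists>u\<in>Hom A M W. h = u \<cdot> e"
  using assms is_kernel_iff is_cokernel_iff unfolding short_exact_def by blast+

section \<open>Factorisation through images, and exactness\<close>

lemma is_kernel_comp_mono_iff:
  assumes "e \<in> Hom A P M" "m \<in> Hom A M Y" "mono_mor A m"
  shows "is_kernel A k (m \<cdot> e) \<longleftrightarrow> is_kernel A k e"
proof -
  note me = Comp_Hom[OF assms(1,2)]
  show ?thesis
  proof (cases "k \<in> Hom A (Dom A k) P")
    case True
    \<comment> \<open>As \<open>m\<close> is mono, \<open>m \<cdot> e\<close> and \<open>e\<close>
      kill the same maps, so the two universal properties agree.\<close>
    have "(m \<cdot> e) \<cdot> h = Zero A W Y \<longleftrightarrow> e \<cdot> h = Zero A W M" if "h \<in> Hom A W P" for W h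
      using Comp_assoc[OF that assms(1,2)] Comp_Hom[OF that assms(1)] Comp_Zero(1)[OF assms(2)]
        Hom_Obj[OF that] assms(3)[unfolded mono_iff_trivial_kernel[OF assms(2)]] by metis
    then show ?thesis
      using is_kernel_iff[OF me True] is_kernel_iff[OF assms(1) True] True by simp
  next
    case False
    then show ?thesis using is_kernel_Hom[OF _ me] is_kernel_Hom[OF _ assms(1)] by blast
  qed
qed

text \<open>If \<open>f = m \<cdot> e\<close> with \<open>m = Ker (Coker f)\<close> and \<open>w \<cdot> e = 0\<close>, then \<open>f\<close> factors through the
  subobject \<open>m \<cdot> Ker w\<close>, which by normality contains \<open>Ker (Coker f)\<close>; hence \<open>w = 0\<close>.\<close>

lemma epi_onto_image:
  assumes "is_image A m f" "f \<in> Hom A X Y"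
  obtains e where "e \<in> Hom A X (Dom A m)" "epi_mor A e" "f = m \<cdot> e"
proof -
  obtain c where c: "is_cokernel A c f" "is_kernel A m c" using assms(1) by (auto simp: is_image_def)
  note cH = is_cokernel_Hom[OF c(1) assms(2)]
  note mH = is_kernel_Hom[OF c(2) cH]
  note C = c(1)[unfolded is_cokernel_iff[OF assms(2) cH]]
  note M = c(2)[unfolded is_kernel_iff[OF cH mH]]
  obtain e where e: "e \<in> Hom A X (Dom A m)" "f = m \<cdot> e" using M C assms(2) by blast
  have "w = Zero A (Dom A m) W" if w: "w \<in> Hom A (Dom A m) W" "w \<cdot> e = Zero A X W" for W w
  proof -
    obtain j where j: "is_kernel A j w" using ex_kernel Hom_Mor[OF w(1)] by blast
    note jH = is_kernel_Hom[OF j w(1)]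
    note J = j[unfolded is_kernel_iff[OF w(1) jH]]
    obtain e' where e': "e' \<in> Hom A X (Dom A j)" "e = j \<cdot> e'" using J e(1) w(2) by blast
    note mj = Comp_Hom[OF jH mH]
    have "mono_mor A (m \<cdot> j)"
      using J M Comp_assoc[OF _ jH mH] mono_iff_trivial_kernel[OF mj]
        mono_iff_trivial_kernel[OF mH] mono_iff_trivial_kernel[OF jH] Comp_Hom[OF _ jH] by metis
    then obtain g where g: "is_kernel A (m \<cdot> j) g" using mono_normal by blast
    then obtain Z where gH: "g \<in> Hom A Y Z"
      using Hom_Cod[OF mj] by (auto simp: is_kernel_def Hom_def)
    note G = g[unfolded is_kernel_iff[OF gH mj]]
    have "f = (m \<cdot> j) \<cdot> e'" using e(2) e' Comp_assoc[OF e'(1) jH mH] by simp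
    then have "g \<cdot> f = Zero A X Z"
      using Comp_assoc[OF e'(1) mj gH] G Comp_Zero(2)[OF e'(1)] Hom_Obj[OF gH] by simp
    then obtain g' where g': "g' \<in> Hom A (Cod A c) Z" "g = g' \<cdot> c" using C gH by blast
    have "g \<cdot> m = Zero A (Dom A m) Z"
      using Comp_assoc[OF mH cH g'(1)] M Comp_Zero(1)[OF g'(1)] Hom_Obj[OF mH] g'(2) by simp
    then obtain t where t: "t \<in> Hom A (Dom A m) (Dom A j)" "m = (m \<cdot> j) \<cdot> t" using G mH by blast
    have idH: "Id A (Dom A m) \<in> Hom A (Dom A m) (Dom A m)" using Id_Hom Hom_Obj[OF mH] by blast
    have "m \<cdot> (j \<cdot> t) = m \<cdot> Id A (Dom A m)"
      using t Comp_assoc[OF t(1) jH mH] Id_right[OF mH] by simp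
    \<comment> \<open>The kernel \<open>j\<close> of \<open>w\<close> now has a right inverse,
      whence \<open>w = w \<cdot> j \<cdot> t = 0\<close>.\<close>
    then have "j \<cdot> t = Id A (Dom A m)"
      using mono_cancel[OF _ mH Comp_Hom[OF t(1) jH] idH] M by blast
    then show "w = Zero A (Dom A m) W"
      using Id_right[OF w(1)] Comp_assoc[OF t(1) jH w(1)] J Comp_Zero(2)[OF t(1)] Hom_Obj[OF w(1)]
      by simp
  qed
  then have "epi_mor A e" using epi_iff_trivial_cokernel[OF e(1)] by blast
  then show thesis using that e by blast
qed

text \<open>Exactness only provides some \<open>m\<close> that is both an image of \<open>f\<close>
  and a kernel of \<open>g\<close>. Comparing it with the given kernel \<open>k\<close> yields
  \<open>u\<close> with right inverse \<open>v\<close>; thus \<open>u\<close> is epi, and the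
  factorisation of \<open>f\<close> through \<open>m\<close> carries over to
  \<open>k\<close>.\<close>

lemma exact_pair_factor:
  assumes "exact_pair A f g" "is_kernel A k g" "f \<in> Hom A X Y"
  obtains e where "e \<in> Hom A X (Dom A k)" "epi_mor A e" "f = k \<cdot> e"
proof -
  obtain m where m: "is_image A m f" "is_kernel A m g" and gH: "g \<in> Hom A Y (Cod A g)"
    using assms(1,3) by (auto simp: exact_pair_def Hom_def)
  obtain e where e: "e \<in> Hom A X (Dom A m)" "epi_mor A e" "f = m \<cdot> e"
    using epi_onto_image[OF m(1) assms(3)] by blast
  note mH = is_kernel_Hom[OF m(2) gH] and kH = is_kernel_Hom[OF assms(2) gH]
  note M = m(2)[unfolded is_kernel_iff[OF gH mH]] and K = assms(2)[unfolded is_kernel_iff[OF gH kH]]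
  obtain u where u: "u \<in> Hom A (Dom A m) (Dom A k)" "m = k \<cdot> u" using M K mH by blast
  obtain v where v: "v \<in> Hom A (Dom A k) (Dom A m)" "k = m \<cdot> v" using M K kH by blast
  have "k \<cdot> (u \<cdot> v) = k \<cdot> Id A (Dom A k)"
    using Comp_assoc[OF v(1) u(1) kH] Id_right[OF kH] by (simp flip: u(2) v(2))
  then have uv: "u \<cdot> v = Id A (Dom A k)"
    using mono_cancel[OF _ kH Comp_Hom[OF v(1) u(1)]] K Id_Hom Hom_Obj[OF kH] by blast
  have "w = Zero A (Dom A k) W"
    if w: "w \<in> Hom A (Dom A k) W" "w \<cdot> (u \<cdot> e) = Zero A X W" for W w
  proof -
    have "w \<cdot> u = Zero A (Dom A m) W"
      using e(2)[unfolded epi_iff_trivial_cokernel[OF e(1)]] w(2) Comp_assoc[OF e(1) u(1) w(1)]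
        Comp_Hom[OF u(1) w(1)] by simp
    then show ?thesis
      using Comp_assoc[OF v(1) u(1) w(1)] uv Id_right[OF w(1)] Comp_Zero(2)[OF v(1)]
        Hom_Obj[OF w(1)] by simp
  qed
  then have "epi_mor A (u \<cdot> e)"
    using epi_iff_trivial_cokernel[OF Comp_Hom[OF e(1) u(1)]] by blast
  moreover have "f = k \<cdot> (u \<cdot> e)" using Comp_assoc[OF e(1) u(1) kH] u e by simp
  ultimately show thesis using that Comp_Hom[OF e(1) u(1)] by blast
qed

text \<open>Precomposition with an epi does not change which maps kill \<open>k\<close>, so the
  cokernel \<open>e\<close> of \<open>k\<close> is also a cokernel of \<open>k \<cdot> q\<close>,
  and its kernel is \<open>k\<close>.\<close>

lemma is_image_comp_epi:
  assumes "short_exact A K P M k e" "q \<in> Hom A W K" "epi_mor A q"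
  shows "is_image A k (k \<cdot> q)"
proof -
  note S = short_exactD[OF assms(1)]
  have "h \<cdot> (k \<cdot> q) = Zero A W Y \<longleftrightarrow> h \<cdot> k = Zero A K Y" if "h \<in> Hom A P Y" for Y h
    using assms(3)[unfolded epi_iff_trivial_cokernel[OF assms(2)]] Comp_assoc[OF assms(2) S(1) that]
      Comp_Hom[OF S(1) that] Comp_Zero(2)[OF assms(2)] Hom_Obj[OF that] by metis
  then have "is_cokernel A e (k \<cdot> q)"
    using is_cokernel_iff[OF Comp_Hom[OF assms(2) S(1)] S(2)] S by simp
  then show ?thesis using assms(1) by (auto simp: is_image_def short_exact_def)
qed

lemma is_image_self:
  assumes "short_exact A K P M k e"
  shows "is_image A k k"
  using assms by (auto simp: is_image_def short_exact_def)

lemma exact_pair_comp_epi: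
  assumes "short_exact A K P M k e" "q \<in> Hom A W K" "epi_mor A q" "is_kernel A k g"
  shows "exact_pair A (k \<cdot> q) g"
  using is_image_comp_epi[OF assms(1-3)] assms(4) Comp_Hom[OF assms(2) short_exactD(1)[OF assms(1)]]
    short_exactD(1)[OF assms(1)]
  unfolding exact_pair_def is_kernel_def by (auto simp: Hom_def)

end

section \<open>Extension groups and syzygies\<close>

lemma (in normal) trivial_FactGroup_iff: "trivial_group (G Mod H) \<longleftrightarrow> H = carrier G"
proof
  assume "trivial_group (G Mod H)"
  then have "(\<lambda>x. H #> x) ` carrier G = {H}"
    by (simp add: trivial_group_def carrier_FactGroup)
  then have "x \<in> H" if "x \<in> carrier G" for x
    using that coset_join1[OF _ that is_subgroup] by blast
  then show "H = carrier G" using subset by blast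
next
  assume "H = carrier G"
  then have "(\<lambda>x. H #> x) ` carrier G = {H}"
    using coset_join2[OF _ is_subgroup] by (auto intro!: image_eqI[where x = "\<one>"])
  then show "trivial_group (G Mod H)"
    using factorgroup_is_group by (simp add: trivial_group_def carrier_FactGroup)
qed

context preadditive_category
begin

lemma precomp_group_hom:
  assumes "f \<in> Hom A X Y" "Q \<in> Obj A"
  shows "group_hom (hom_group A Y Q) (hom_group A X Q) (precomp A f)"
proof -
  interpret G: comm_group "hom_group A Y Q" using hom_comm_group Hom_Obj[OF assms(1)] assms(2) by blast
  interpret H: comm_group "hom_group A X Q" using hom_comm_group Hom_Obj[OF assms(1)] assms(2) by blast
  have "precomp A f \<in> hom (hom_group A Y Q) (hom_group A X Q)"
    using assms(1) Comp_Hom Comp_Add_left by (auto simp: hom_def precomp_def)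
  then show ?thesis
    by (simp add: group_hom_def group_hom_axioms_def G.group_axioms H.group_axioms)
qed

text \<open>A quotient group is trivial exactly when the subgroup is everything. The degree is a
  successor because \<open>perp_proj\<close> tests positive degrees, and there the coboundaries are
  the image under \<open>d i\<close>.\<close>

lemma trivial_Ext_iff:
  assumes d: "d i \<in> Hom A (P (Suc i)) (P i)" "d (Suc i) \<in> Hom A (P (Suc (Suc i))) (P (Suc i))"
    and zero: "d i \<cdot> d (Suc i) = Zero A (P (Suc (Suc i))) (P i)" and Y: "Y \<in> Obj A"
  shows "trivial_group (ext_of_resolution A P d (Suc i) Y) \<longleftrightarrow>
    {h \<in> Hom A (P (Suc i)) Y. h \<cdot> d (Suc i) = Zero A (P (Suc (Suc i))) Y} =
    (\<lambda>g. g \<cdot> d i) ` Hom A (P i) Y"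
proof -
  let ?G = "hom_group A (P (Suc i)) Y"
  let ?Z = "ext_cocycles A P d (Suc i) Y" and ?B = "ext_coboundaries A P d (Suc i) Y"
  interpret out: group_hom "hom_group A (P (Suc i)) Y" "hom_group A (P (Suc (Suc i))) Y"
      "precomp A (d (Suc i))"
    using precomp_group_hom d(2) Y .
  interpret inc: group_hom "hom_group A (P i) Y" "hom_group A (P (Suc i)) Y" "precomp A (d i)"
    using precomp_group_hom d(1) Y .
  have Z_eq: "?Z = {h \<in> Hom A (P (Suc i)) Y. h \<cdot> d (Suc i) = Zero A (P (Suc (Suc i))) Y}"
    by (simp add: ext_cocycles_def kernel_def precomp_def)
  have B_eq: "?B = (\<lambda>g. g \<cdot> d i) ` Hom A (P i) Y" by (simp add: precomp_def)
  have "?B \<subseteq> ?Z"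
    unfolding Z_eq B_eq using Comp_Hom[OF d(1)] Comp_assoc[OF d(2) d(1)] zero Comp_Zero(1)
      Hom_Obj[OF d(2)] by auto
  have Z: "subgroup ?Z ?G" using out.subgroup_kernel by (simp add: ext_cocycles_def)
  \<comment> \<open>Commutativity of the group of cocycles makes the coboundaries a normal subgroup
    of it.\<close>
  have "Add A x y = Add A y x" if "x \<in> ?Z" "y \<in> ?Z" for x y
    using that subgroup.subset[OF Z] Add_commute by (metis hom_group_simps(1) subsetD)
  then have "comm_group (?G\<lparr>carrier := ?Z\<rparr>)"
    using group.group_comm_groupI[OF subgroup.subgroup_is_group[OF Z out.G.group_axioms]] by simp
  moreover have "subgroup ?B (?G\<lparr>carrier := ?Z\<rparr>)"
    using out.G.subgroup_incl[OF _ Z \<open>?B \<subseteq> ?Z\<close>] inc.img_is_subgroup by simp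
  ultimately have "?B \<lhd> (?G\<lparr>carrier := ?Z\<rparr>)" using comm_group.subgroup_imp_normal by blast
  moreover have "carrier (?G\<lparr>carrier := ?Z\<rparr>) = ?Z" by simp
  ultimately have "trivial_group (?G\<lparr>carrier := ?Z\<rparr> Mod ?B) \<longleftrightarrow> ?Z = ?B"
    using normal.trivial_FactGroup_iff by metis
  then show ?thesis unfolding ext_of_resolution_def Z_eq B_eq .
qed

end

text \<open>The identity of \<open>M'\<close> factors through \<open>M\<close> up to a map that factors through a projective.
  Since this relation passes to syzygies, it replaces chain homotopies in comparing two projective
  resolutions.\<close>

definition stable_retract ::
    "('o, 'm, 'x) ab_category_scheme \<Rightarrow> 'o \<Rightarrow> 'o \<Rightarrow> bool" where
  "stable_retract A M' M \<longleftrightarrow> M' \<in> Obj A \<and> (\<exists>Q. projective A Q \<and>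
    (\<exists>d\<in>Hom A M' M. \<exists>b\<in>Hom A M M'. \<exists>t\<in>Hom A M' Q. \<exists>s\<in>Hom A Q M'.
      b \<cdot>\<^bsub>A\<^esub> d = Add A (Id A M') (s \<cdot>\<^bsub>A\<^esub> t)))"

definition proj_presentation ::
    "('o, 'm, 'x) ab_category_scheme \<Rightarrow> 'o \<Rightarrow> 'o \<Rightarrow> 'o \<Rightarrow> 'm \<Rightarrow> 'm \<Rightarrow> bool" where
  "proj_presentation A K P M k e \<longleftrightarrow> short_exact A K P M k e \<and> projective A P"

text \<open>A projective resolution of \<open>Z 0\<close> cut into short exact pieces, so that the
  syzygies and their inclusions become data; the differentials are recovered as
  \<open>k n \<cdot> e (Suc n)\<close>.\<close>

definition syzygy_chain ::
    "('o, 'm, 'x) ab_category_scheme \<Rightarrow> (nat \<Rightarrow> 'o) \<Rightarrow> (nat \<Rightarrow> 'o) \<Rightarrow> (nat \<Rightarrow> 'm) \<Rightarrow> (nat \<Rightarrow> 'm) \<Rightarrow> bool"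
  where
  "syzygy_chain A Z P k e \<longleftrightarrow> (\<forall>n. proj_presentation A (Z (Suc n)) (P n) (Z n) (k n) (e n))"

context abelian_category
begin

section \<open>Projective presentations and syzygies of stable retracts\<close>

lemma projective_lift:
  assumes "projective A P" "epi_mor A e" "e \<in> Hom A X Y" "f \<in> Hom A P Y"
  obtains g where "g \<in> Hom A P X" "f = e \<cdot> g"
  using assms Hom_Dom[OF assms(3)] Hom_Cod[OF assms(3)] unfolding projective_def by metis

lemma proj_presentationD:
  assumes "proj_presentation A K P M k e"
  shows "short_exact A K P M k e" "projective A P"
  using assms by (auto simp: proj_presentation_def)

lemma left_proj_approx_iff:
  assumes "k \<in> Hom A K P" "projective A P"
  shows "left_proj_approx A k \<longleftrightarrow> (\<forall>Q. projective A Q \<longrightarrow> (\<forall>h\<in>Hom A K Q. \<exists>g\<in>Hom A P Q. h = g \<cdot> k))"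
  using assms by (auto simp: left_proj_approx_def Hom_def)

lemma stable_retract_refl:
  assumes "M \<in> Obj A" "enough_projectives A"
  shows "stable_retract A M M"
proof -
  \<comment> \<open>Any projective will do, as the correction term through it is taken to be
    zero.\<close>
  obtain Q where Q: "projective A Q" using assms by (auto simp: enough_projectives_def)
  then have "Q \<in> Obj A" by (auto simp: projective_def)
  note zero = Zero_Hom[OF assms(1) this] Zero_Hom[OF this assms(1)]
  have "Id A M \<cdot> Id A M = Add A (Id A M) (Zero A Q M \<cdot> Zero A M Q)"
    using Id_left[OF Id_Hom[OF assms(1)]] Comp_Zero(2)[OF zero(1) assms(1)]
      Add_Zero(1)[OF Id_Hom[OF assms(1)]] by simp
  then show ?thesis
    using Q zero Id_Hom[OF assms(1)] assms(1) unfolding stable_retract_def by blast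
qed

text \<open>The identity \<open>b d = 1 + s t\<close> lifts to \<open>c a = 1 + \<sigma> t e' + k' u\<close> on \<open>P'\<close>; composing with \<open>k'\<close>
  kills the middle term.\<close>

lemma stable_retract_lift:
  assumes "stable_retract A M' M" "proj_presentation A K P M k e" "proj_presentation A K' P' M' k' e'"
  obtains a x y u where "a \<in> Hom A P' P" "x \<in> Hom A K' K" "y \<in> Hom A K K'" "u \<in> Hom A P' K'"
    "k \<cdot> x = a \<cdot> k'" "y \<cdot> x = Add A (Id A K') (u \<cdot> k')"
proof -
  obtain Q d b t s where Q: "projective A Q"
    and h: "d \<in> Hom A M' M" "b \<in> Hom A M M'" "t \<in> Hom A M' Q" "s \<in> Hom A Q M'"
    and bd: "b \<cdot> d = Add A (Id A M') (s \<cdot> t)"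
    using assms(1) unfolding stable_retract_def by blast
  note S = proj_presentationD[OF assms(2)] and S' = proj_presentationD[OF assms(3)]
  note E = short_exactD[OF S(1)] and E' = short_exactD[OF S'(1)]
  obtain a where a: "a \<in> Hom A P' P" "d \<cdot> e' = e \<cdot> a"
    using projective_lift[OF S'(2) E(4,2) Comp_Hom[OF E'(2) h(1)]] by blast
  obtain c where c: "c \<in> Hom A P P'" "b \<cdot> e = e' \<cdot> c"
    using projective_lift[OF S(2) E'(4,2) Comp_Hom[OF E(2) h(2)]] by blast
  obtain \<sigma> where \<sigma>: "\<sigma> \<in> Hom A Q P'" "s = e' \<cdot> \<sigma>"
    using projective_lift[OF Q E'(4,2) h(4)] by blast
  note objs = Hom_Obj[OF E'(1)] Hom_Obj[OF E(1)] Hom_Obj[OF E(2)] Hom_Obj[OF E'(2)]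
  have "e \<cdot> (a \<cdot> k') = Zero A K' M"
    using Comp_assoc[OF E'(1) a(1) E(2)] Comp_assoc[OF E'(1,2) h(1)] a(2) E'(5)
      Comp_Zero(1)[OF h(1)] objs by simp
  then obtain x where x: "x \<in> Hom A K' K" "a \<cdot> k' = k \<cdot> x"
    using E(6) Comp_Hom[OF E'(1) a(1)] by blast
  have "e' \<cdot> (c \<cdot> k) = Zero A K M'"
    using Comp_assoc[OF E(1) c(1) E'(2)] Comp_assoc[OF E(1,2) h(2)] c(2) E(5)
      Comp_Zero(1)[OF h(2)] objs by simp
  then obtain y where y: "y \<in> Hom A K K'" "c \<cdot> k = k' \<cdot> y"
    using E'(6) Comp_Hom[OF E(1) c(1)] by blast
  let ?I = "Id A P'" and ?r = "\<sigma> \<cdot> (t \<cdot> e')"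
  note te = Comp_Hom[OF E'(2) h(3)]
  have H: "?I \<in> Hom A P' P'" "?r \<in> Hom A P' P'" "c \<cdot> a \<in> Hom A P' P'"
    using Id_Hom objs Comp_Hom te \<sigma>(1) c(1) a(1) by blast+
  have "e' \<cdot> (c \<cdot> a) = e' \<cdot> Add A ?I ?r"
  proof -
    have "e' \<cdot> (c \<cdot> a) = (b \<cdot> e) \<cdot> a" using Comp_assoc[OF a(1) c(1) E'(2)] c(2) by simp
    also have "\<dots> = (b \<cdot> d) \<cdot> e'"
      using Comp_assoc[OF a(1) E(2) h(2)] Comp_assoc[OF E'(2) h(1,2)] a(2) by simp
    also have "\<dots> = Add A (Id A M' \<cdot> e') ((s \<cdot> t) \<cdot> e')"
      using bd Comp_Add_left[OF E'(2) Id_Hom Comp_Hom[OF h(3,4)]] objs by simp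
    also have "\<dots> = Add A (e' \<cdot> ?I) (e' \<cdot> ?r)"
      using Id_left[OF E'(2)] Id_right[OF E'(2)] Comp_assoc[OF E'(2) h(3,4)]
        Comp_assoc[OF te \<sigma>(1) E'(2)] \<sigma>(2) by simp
    finally show ?thesis using Comp_Add_right[OF H(1,2) E'(2)] by simp
  qed
  moreover obtain w where w: "w \<in> Hom A P' P'" "c \<cdot> a = Add A (Add A ?I ?r) w"
    using ex_difference[OF H(3) Add_Hom[OF H(1,2)]] by blast
  ultimately have "Add A (e' \<cdot> Add A ?I ?r) (e' \<cdot> w) = Add A (e' \<cdot> Add A ?I ?r) (Zero A P' M')"
    using Comp_Add_right[OF Add_Hom[OF H(1,2)] w(1) E'(2)]
      Add_Zero(1)[OF Comp_Hom[OF Add_Hom[OF H(1,2)] E'(2)]] by simp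
  then have "e' \<cdot> w = Zero A P' M'"
    using Add_cancel[OF Comp_Hom[OF Add_Hom[OF H(1,2)] E'(2)] Comp_Hom[OF w(1) E'(2)]]
      Zero_Hom objs by blast
  then obtain u where u: "u \<in> Hom A P' K'" "w = k' \<cdot> u" using E'(6) w(1) by blast
  have uk: "u \<cdot> k' \<in> Hom A K' K'" using Comp_Hom u(1) E'(1) by blast
  have idK: "Id A K' \<in> Hom A K' K'" using Id_Hom objs by blast
  have "?r \<cdot> k' = Zero A K' P'"
  proof -
    have "(t \<cdot> e') \<cdot> k' = Zero A K' Q"
      using Comp_assoc[OF E'(1,2) h(3)] E'(5) Comp_Zero(1)[OF h(3)] objs by simp
    then show ?thesis using Comp_assoc[OF E'(1) te \<sigma>(1)] Comp_Zero(1)[OF \<sigma>(1)] objs by simp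
  qed
  then have r: "Add A ?I ?r \<cdot> k' = k'"
    using Comp_Add_left[OF E'(1) H(1,2)] Id_left[OF E'(1)] Add_Zero(1)[OF E'(1)] by simp
  have "k' \<cdot> (y \<cdot> x) = (c \<cdot> a) \<cdot> k'"
    using Comp_assoc[OF x(1) y(1) E'(1)] Comp_assoc[OF x(1) E(1) c(1)]
      Comp_assoc[OF E'(1) a(1) c(1)] y(2) x(2) by simp
  also have "\<dots> = Add A k' (w \<cdot> k')"
    using Comp_Add_left[OF E'(1) Add_Hom[OF H(1,2)] w(1)] w(2) r by simp
  also have "\<dots> = k' \<cdot> Add A (Id A K') (u \<cdot> k')"
    using Comp_Add_right[OF idK uk E'(1)] Id_right[OF E'(1)] Comp_assoc[OF E'(1) u(1) E'(1)] u(2)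
    by simp
  finally have "y \<cdot> x = Add A (Id A K') (u \<cdot> k')"
    using mono_cancel[OF E'(3,1) Comp_Hom[OF x(1) y(1)] Add_Hom[OF idK uk]] by blast
  then show thesis using that a(1) x y(1) u(1) by metis
qed

text \<open>The correction term for the syzygies is \<open>u \<cdot> k'\<close>, which passes
  through the projective \<open>P'\<close>.\<close>

lemma stable_retract_syzygy:
  assumes "stable_retract A M' M" "proj_presentation A K P M k e" "proj_presentation A K' P' M' k' e'"
  shows "stable_retract A K' K"
proof -
  note k' = short_exactD(1)[OF proj_presentationD(1)[OF assms(3)]]
  show ?thesis
    using stable_retract_lift[OF assms] proj_presentationD(2)[OF assms(3)] k' Hom_Obj[OF k']
    unfolding stable_retract_def by metis
qed

text \<open>For \<open>f\<close> on \<open>K'\<close>, the map \<open>f \<cdot> y\<close> on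
  \<open>K\<close> extends along \<open>k\<close> to some \<open>g\<close>. From
  \<open>y \<cdot> x = 1 + u \<cdot> k'\<close> one gets \<open>f = w \<cdot> k'\<close>, where
  \<open>w\<close> is the difference of \<open>g \<cdot> a\<close> and
  \<open>f \<cdot> u\<close>.\<close>

lemma left_proj_approx_stable_retract:
  assumes "stable_retract A M' M" "proj_presentation A K P M k e" "proj_presentation A K' P' M' k' e'"
    and "left_proj_approx A k"
  shows "left_proj_approx A k'"
proof -
  obtain a x y u where h: "a \<in> Hom A P' P" "x \<in> Hom A K' K" "y \<in> Hom A K K'" "u \<in> Hom A P' K'"
    and eq: "k \<cdot> x = a \<cdot> k'" "y \<cdot> x = Add A (Id A K') (u \<cdot> k')"
    using stable_retract_lift[OF assms(1-3)] by blast
  note S = proj_presentationD[OF assms(2)] and S' = proj_presentationD[OF assms(3)]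
  note k = short_exactD(1)[OF S(1)] and k' = short_exactD(1)[OF S'(1)]
  have idK: "Id A K' \<in> Hom A K' K'" using Id_Hom Hom_Obj[OF k'] by blast
  have "\<exists>g\<in>Hom A P' Q. f = g \<cdot> k'" if Q: "projective A Q" and f: "f \<in> Hom A K' Q" for Q f
  proof -
    obtain g where g: "g \<in> Hom A P Q" "f \<cdot> y = g \<cdot> k"
      using assms(4)[unfolded left_proj_approx_iff[OF k S(2)]] Q Comp_Hom[OF h(3) f] by blast
    note ga = Comp_Hom[OF h(1) g(1)] and fu = Comp_Hom[OF h(4) f]
    obtain w where w: "w \<in> Hom A P' Q" "g \<cdot> a = Add A (f \<cdot> u) w" using ex_difference[OF ga fu] .
    note fuk = Comp_Hom[OF k' fu]
    have "Add A ((f \<cdot> u) \<cdot> k') (w \<cdot> k') = (g \<cdot> a) \<cdot> k'"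
      using Comp_Add_left[OF k' fu w(1)] w(2) by simp
    also have "\<dots> = f \<cdot> (y \<cdot> x)"
      using Comp_assoc[OF k' h(1) g(1)] Comp_assoc[OF h(2) k g(1)] Comp_assoc[OF h(2,3) f] g(2) eq(1)
      by simp
    also have "\<dots> = Add A f ((f \<cdot> u) \<cdot> k')"
      using eq(2) Comp_Add_right[OF idK Comp_Hom[OF k' h(4)] f] Id_right[OF f]
        Comp_assoc[OF k' h(4) f] by simp
    also have "\<dots> = Add A ((f \<cdot> u) \<cdot> k') f" using Add_commute[OF f fuk] .
    finally show ?thesis using Add_cancel[OF fuk Comp_Hom[OF k' w(1)] f] w(1) by blast
  qed
  then show ?thesis using left_proj_approx_iff[OF k' S'(2)] by blast
qed

text \<open>The relation descends from syzygy to syzygy. For two chains with the same starting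
  object this shows that the approximation property depends on that object alone, just as Ext does
  not depend on the resolution.\<close>

lemma syzygy_chain_approx:
  assumes "stable_retract A (Z' 0) (Z 0)" "syzygy_chain A Z P k e" "syzygy_chain A Z' P' k' e'"
    and "\<forall>n. left_proj_approx A (k n)"
  shows "left_proj_approx A (k' n)"
proof -
  note chain = assms(2,3)[unfolded syzygy_chain_def]
  have "stable_retract A (Z' n) (Z n)" for n
    using assms(1) chain stable_retract_syzygy by (induction n) blast+
  then show ?thesis using chain assms(4) left_proj_approx_stable_retract by blast
qed

text \<open>For a cochain complex with differentials \<open>k q\<close> and \<open>k' e\<close>, the cocycles with values in \<open>Q\<close> are
  the maps \<open>h e\<close> with \<open>h\<close> defined on the intermediate image \<open>Z\<close>.\<close>

lemma cocycles_eq_coboundaries_iff: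
  assumes "short_exact A K P Z k e" "q \<in> Hom A W K" "epi_mor A q" "k' \<in> Hom A Z P'" "Q \<in> Obj A"
  shows "{h \<in> Hom A P Q. h \<cdot> (k \<cdot> q) = Zero A W Q} = (\<lambda>g. g \<cdot> (k' \<cdot> e)) ` Hom A P' Q \<longleftrightarrow>
    (\<forall>h\<in>Hom A Z Q. \<exists>g\<in>Hom A P' Q. h = g \<cdot> k')" (is "?C = ?B \<longleftrightarrow> _")
proof -
  note S = short_exactD[OF assms(1)]
  have "h \<cdot> (k \<cdot> q) = Zero A W Q \<longleftrightarrow> h \<cdot> k = Zero A K Q" if "h \<in> Hom A P Q" for h
    using assms(3)[unfolded epi_iff_trivial_cokernel[OF assms(2)]] Comp_assoc[OF assms(2) S(1) that]
      Comp_Hom[OF S(1) that] Comp_Zero(2)[OF assms(2)] assms(5) by metis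
  moreover have "(h \<cdot> e) \<cdot> k = Zero A K Q" if "h \<in> Hom A Z Q" for h
    using Comp_assoc[OF S(1,2) that] S(5) Comp_Zero(1)[OF that] Hom_Obj[OF S(1)] by simp
  ultimately have C: "?C = (\<lambda>h. h \<cdot> e) ` Hom A Z Q"
    using S(7) Comp_Hom[OF S(2)] by (auto simp: image_iff)
  have "?B = (\<lambda>h. h \<cdot> e) ` (\<lambda>g. g \<cdot> k') ` Hom A P' Q"
    using Comp_assoc[OF S(2) assms(4)] by (auto simp: image_image intro!: image_cong)
  \<comment> \<open>Precomposition with the epi \<open>e\<close> is injective, so the two images may
    be compared before it is applied.\<close>
  moreover have "inj_on (\<lambda>h. h \<cdot> e) (Hom A Z Q)"
    using epi_cancel[OF S(4,2)] by (auto simp: inj_on_def)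
  moreover have "(\<lambda>g. g \<cdot> k') ` Hom A P' Q \<subseteq> Hom A Z Q" using Comp_Hom[OF assms(4)] by blast
  ultimately have "?C = ?B \<longleftrightarrow> Hom A Z Q = (\<lambda>g. g \<cdot> k') ` Hom A P' Q"
    using C inj_on_image_eq_iff by (metis (no_types, lifting) subset_refl)
  then show ?thesis using Comp_Hom[OF assms(4)] by blast
qed

text \<open>Since \<open>k'\<close> is mono, \<open>d\<close> and its epi part \<open>e\<close> have
  the same kernels, and an epi together with its kernel is short exact.\<close>

lemma short_exact_kernel_factor:
  assumes "is_kernel A k d" "d \<in> Hom A P P'" "d = k' \<cdot> e" "e \<in> Hom A P M" "epi_mor A e"
    "k' \<in> Hom A M P'" "mono_mor A k'"
  shows "short_exact A (Dom A k) P M k e"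
  using assms is_kernel_comp_mono_iff[OF assms(4,6,7)] short_exact_of_epi by blast

section \<open>Resolutions cut into syzygy chains and spliced back\<close>

lemma syzygy_chain_of_resolution:
  assumes "projective_resolution A X P d e"
  obtains Z k q where "syzygy_chain A Z P k q" "Z 0 = X" "\<And>n. d n = k n \<cdot> q (Suc n)"
proof -
  have proj: "\<And>n. projective A (P n)" and e: "e \<in> Hom A (P 0) X" "epi_mor A e"
    and d: "\<And>n. d n \<in> Hom A (P (Suc n)) (P n)"
    and ex: "exact_pair A (d 0) e" "\<And>n. exact_pair A (d (Suc n)) (d n)"
    using assms by (auto simp: projective_resolution_def)
  \<comment> \<open>The map leaving \<open>P n\<close>: the augmentation in degree 0, then the
    differentials shifted by one. Its kernel is the next syzygy.\<close>
  define d' where "d' n = (case n of 0 \<Rightarrow> e | Suc m \<Rightarrow> d m)" for n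
  have d': "d' n \<in> Hom A (P n) (case n of 0 \<Rightarrow> X | Suc m \<Rightarrow> P m)" for n
    using e d by (auto simp: d'_def split: nat.split)
  have "\<forall>n. \<exists>k. is_kernel A k (d' n)" using ex_kernel Hom_Mor d' by blast
  then obtain k where k: "\<And>n. is_kernel A (k n) (d' n)" by metis
  have "\<exists>q. q \<in> Hom A (P (Suc n)) (Dom A (k n)) \<and> epi_mor A q \<and> d n = k n \<cdot> q" for n
  proof -
    have "exact_pair A (d n) (d' n)" using ex by (cases n) (auto simp: d'_def)
    then show ?thesis using exact_pair_factor k d by metis
  qed
  then obtain p where p: "\<And>n. p n \<in> Hom A (P (Suc n)) (Dom A (k n))" "\<And>n. epi_mor A (p n)"
      "\<And>n. d n = k n \<cdot> p n" by metis
  \<comment> \<open>Degree 0 is set to \<open>X\<close> itself, the target of the augmentation;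
    later syzygies are the domains of the chosen kernels.\<close>
  define Z where "Z n = (case n of 0 \<Rightarrow> X | Suc m \<Rightarrow> Dom A (k m))" for n
  define q where "q n = (case n of 0 \<Rightarrow> e | Suc m \<Rightarrow> p m)" for n
  have "proj_presentation A (Z (Suc n)) (P n) (Z n) (k n) (q n)" for n
  proof (cases n)
    case 0
    then show ?thesis
      using short_exact_of_epi[OF e(2,1)] k[of 0] proj
      by (simp add: proj_presentation_def Z_def q_def d'_def)
  next
    case (Suc m)
    note km = is_kernel_Hom[OF k d', of m]
    have "short_exact A (Dom A (k n)) (P n) (Dom A (k m)) (k n) (p m)"
      using short_exact_kernel_factor[OF _ d p(3) p(1,2), of "k n" m] k[of n] Suc
        k[of m, unfolded is_kernel_iff[OF d' km]] d is_kernel_Hom[OF k d', of m]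
        Comp_Hom[OF p(1) km] Hom_Cod[OF d, of m] Hom_Cod[OF Comp_Hom[OF p(1) km]] p(3)[of m] km
      by (simp add: d'_def)
    then show ?thesis using Suc proj by (simp add: proj_presentation_def Z_def q_def)
  qed
  then have "syzygy_chain A Z P k q" by (simp add: syzygy_chain_def)
  then show thesis using that[of Z k q] p(3) by (simp add: Z_def q_def)
qed

lemma syzygy_chain_resolution:
  assumes "syzygy_chain A Z P k e"
  shows "projective_resolution A (Z 0) P (\<lambda>n. k n \<cdot> e (Suc n)) (e 0)"
proof -
  have S: "short_exact A (Z (Suc n)) (P n) (Z n) (k n) (e n)" "projective A (P n)" for n
    using assms by (auto simp: syzygy_chain_def proj_presentation_def)
  note E = short_exactD[OF S(1)]
  have ker: "is_kernel A (k n) (e n)" for n using S(1) by (auto simp: short_exact_def)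
  have "is_kernel A (k (Suc n)) (k n \<cdot> e (Suc n))" for n
    using is_kernel_comp_mono_iff[OF E(2) E(1,3)] ker by blast
  then show ?thesis
    using S(2) E(2,4) Comp_Hom[OF E(2) E(1)] exact_pair_comp_epi[OF S(1) E(2,4)] ker
    by (auto simp: projective_resolution_def)
qed

end

section \<open>The left orthogonal class of the projectives\<close>

locale abelian_category_enough_projectives = abelian_category +
  assumes enough: "enough_projectives A"
begin

lemma ex_proj_presentation:
  assumes "M \<in> Obj A"
  obtains K P k e where "proj_presentation A K P M k e"
proof -
  obtain P e where P: "projective A P" "e \<in> Hom A P M" "epi_mor A e"
    using enough assms by (auto simp: enough_projectives_def)
  obtain k where "is_kernel A k e" using ex_kernel Hom_Mor[OF P(2)] by blast
  then show thesis
    using that short_exact_of_epi[OF P(3,2)] P(1) unfolding proj_presentation_def by blast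
qed

lemma ex_syzygy_chain:
  assumes "M \<in> Obj A"
  obtains Z P k e where "syzygy_chain A Z P k e" "Z 0 = M"
proof -
  have "\<forall>X. \<exists>K P k e. X \<in> Obj A \<longrightarrow> proj_presentation A K P X k e"
    using ex_proj_presentation by metis
  \<comment> \<open>Presentations are chosen as functions of the object, so that taking syzygies can
    be iterated.\<close>
  then obtain K P k e where F: "\<And>X. X \<in> Obj A \<Longrightarrow> proj_presentation A (K X) (P X) X (k X) (e X)"
    by metis
  define Z where "Z n = (K ^^ n) M" for n
  have K_Obj: "K X \<in> Obj A" if "X \<in> Obj A" for X
    using Hom_Obj(1)[OF short_exactD(1)[OF proj_presentationD(1)[OF F[OF that]]]] .
  have "Z n \<in> Obj A" for n
    using assms K_Obj by (induction n) (auto simp: Z_def)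
  then have "syzygy_chain A Z (P \<circ> Z) (k \<circ> Z) (e \<circ> Z)"
    using F by (auto simp: syzygy_chain_def Z_def)
  then show thesis using that by (simp add: Z_def)
qed

text \<open>\<open>Ext\<close> is computed from \<open>chosen_resolution\<close>, so the criterion
  is first proved for the chain cut out of that particular resolution.\<close>

lemma perp_proj_iff_some_chain:
  assumes "M \<in> Obj A"
  obtains Z P k e where "syzygy_chain A Z P k e" "Z 0 = M"
    "M \<in> perp_proj A \<longleftrightarrow> (\<forall>n. left_proj_approx A (k n))"
proof -
  obtain P d where Pd: "chosen_resolution A M = (P, d)" by fastforce
  obtain Z0 P0 k0 e0 where "syzygy_chain A Z0 P0 k0 e0" "Z0 0 = M"
    using ex_syzygy_chain assms by blast
  \<comment> \<open>Splicing some chain produces a resolution, so the choice behind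
    \<open>chosen_resolution\<close> really returns one.\<close>
  then have "\<exists>x. case x of (P, d) \<Rightarrow> \<exists>e. projective_resolution A M P d e"
    using syzygy_chain_resolution by blast
  from someI_ex[OF this] obtain e where "projective_resolution A M P d e"
    using Pd by (auto simp: chosen_resolution_def)
  then obtain Z k q where chain: "syzygy_chain A Z P k q" "Z 0 = M"
    and d: "\<And>n. d n = k n \<cdot> q (Suc n)" using syzygy_chain_of_resolution by blast
  have S: "short_exact A (Z (Suc n)) (P n) (Z n) (k n) (q n)" "projective A (P n)" for n
    using chain(1) by (auto simp: syzygy_chain_def proj_presentation_def)
  note E = short_exactD[OF S(1)]
  have dH: "d n \<in> Hom A (P (Suc n)) (P n)" for n using Comp_Hom[OF E(2) E(1)] d by simp
  have "d n \<cdot> d (Suc n) = Zero A (P (Suc (Suc n))) (P n)" for n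
  proof -
    have "q (Suc n) \<cdot> d (Suc n) = Zero A (P (Suc (Suc n))) (Z (Suc n))"
      using Comp_assoc[OF E(2) E(1) E(2)] E(5) Comp_Zero(2)[OF E(2)] Hom_Obj(2)[OF E(2)] d by simp
    then show ?thesis
      using Comp_assoc[OF dH E(2) E(1)] Comp_Zero(1)[OF E(1)] Hom_Obj(1)[OF E(2)] d by simp
  qed
  \<comment> \<open>Cohomology at \<open>P (Suc n)\<close> has intermediate image
    \<open>Z (Suc n)\<close> and tests the inclusion \<open>k n\<close>; hence the positive degrees
    of Ext correspond to all \<open>n\<close>.\<close>
  then have "trivial_group (Ext A (Suc n) M Q) \<longleftrightarrow>
      (\<forall>h\<in>Hom A (Z (Suc n)) Q. \<exists>g\<in>Hom A (P n) Q. h = g \<cdot> k n)" if "projective A Q" for n Q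
    using that trivial_Ext_iff[of d n P Q, OF dH dH] cocycles_eq_coboundaries_iff[OF S(1) E(2,4) E(1)]
    by (simp add: Ext_def Pd d projective_def)
  then have "M \<in> perp_proj A \<longleftrightarrow> (\<forall>n. left_proj_approx A (k n))"
    using assms left_proj_approx_iff[OF E(1) S(2)]
    by (auto simp: perp_proj_def Suc_le_eq gr0_conv_Suc)
  then show thesis using that chain by blast
qed

text \<open>The particular chain is compared with the given one in both directions, through the
  identity of \<open>Z 0\<close>.\<close>

lemma perp_proj_iff_chain:
  assumes "syzygy_chain A Z P k e"
  shows "Z 0 \<in> perp_proj A \<longleftrightarrow> (\<forall>n. left_proj_approx A (k n))"
proof -
  have "Z 0 \<in> Obj A"
    using assms Hom_Obj short_exactD(2) proj_presentationD(1) unfolding syzygy_chain_def by metis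
  from perp_proj_iff_some_chain[OF this] show ?thesis
    using syzygy_chain_approx stable_retract_refl[OF \<open>Z 0 \<in> Obj A\<close> enough] assms by metis
qed

text \<open>Dimension shifting: putting the presentation in front of a chain for \<open>K\<close>
  gives a chain for \<open>M\<close>, whose conditions are those for \<open>K\<close> and the one on
  \<open>k\<close>.\<close>

lemma perp_proj_syzygy_iff:
  assumes "proj_presentation A K P M k e"
  shows "M \<in> perp_proj A \<longleftrightarrow> K \<in> perp_proj A \<and> left_proj_approx A k"
proof -
  have "K \<in> Obj A" using assms Hom_Obj short_exactD(1) proj_presentationD(1) by metis
  then obtain Z Q j p where chain: "syzygy_chain A Z Q j p" "Z 0 = K"
    using ex_syzygy_chain by blast
  let ?j = "case_nat k j"
  have "syzygy_chain A (case_nat M Z) (case_nat P Q) ?j (case_nat e p)"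
    using chain assms by (auto simp: syzygy_chain_def split: nat.split)
  from perp_proj_iff_chain[OF this]
  have "M \<in> perp_proj A \<longleftrightarrow> (\<forall>n. left_proj_approx A (?j n))" by simp
  also have "\<dots> \<longleftrightarrow> left_proj_approx A k \<and> (\<forall>n. left_proj_approx A (j n))"
    by (metis nat.case nat.exhaust)
  finally show ?thesis using perp_proj_iff_chain[OF chain(1)] chain(2) by blast
qed

end

section \<open>Complete resolutions\<close>

text \<open>A totally acyclic complex cut at its cocycles: \<open>Z i\<close> is the kernel of the
  differential leaving \<open>P i\<close>. Indices increase along the maps, opposite to
  \<open>syzygy_chain\<close>; acyclicity under Hom into projectives turns into the approximation
  condition.\<close>

definition complete_chain ::
    "('o, 'm, 'x) ab_category_scheme \<Rightarrow> (int \<Rightarrow> 'o) \<Rightarrow> (int \<Rightarrow> 'o) \<Rightarrow> (int \<Rightarrow> 'm) \<Rightarrow> (int \<Rightarrow> 'm) \<Rightarrow> bool"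
  where
  "complete_chain A Z P k e \<longleftrightarrow>
    (\<forall>i. proj_presentation A (Z i) (P i) (Z (i + 1)) (k i) (e i) \<and> left_proj_approx A (k i))"

context abelian_category
begin

lemma complete_chainD:
  assumes "complete_chain A Z P k e"
  shows "proj_presentation A (Z i) (P i) (Z (i + 1)) (k i) (e i)"
    "short_exact A (Z i) (P i) (Z (i + 1)) (k i) (e i)" "projective A (P i)"
    "left_proj_approx A (k i)"
  using assms by (auto simp: complete_chain_def proj_presentation_def)

text \<open>Facts about the spliced differentials \<open>k (i + 1) \<cdot> e i\<close>. The
  exactness starting with \<open>k i\<close> is for sequences that are cut off on the left at
  \<open>Z i\<close>.\<close>

lemma complete_chain_exact:
  assumes "complete_chain A Z P k e"
  shows "k (i + 1) \<cdot> e i \<in> Hom A (P i) (P (i + 1))"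
    and "is_kernel A (k i) (k (i + 1) \<cdot> e i)"
    and "is_image A (k (i + 1)) (k (i + 1) \<cdot> e i)"
    and "exact_pair A (k i) (k (i + 1) \<cdot> e i)"
    and "exact_pair A (k (i + 1) \<cdot> e i) (k (i + 1 + 1) \<cdot> e (i + 1))"
proof -
  note S = complete_chainD(2)[OF assms]
  note E = short_exactD[OF S]
  have "is_kernel A (k i) (e i)" for i using S by (auto simp: short_exact_def)
  then have ker: "is_kernel A (k i) (k (i + 1) \<cdot> e i)" for i
    using is_kernel_comp_mono_iff[OF E(2) E(1,3)] by blast
  show "k (i + 1) \<cdot> e i \<in> Hom A (P i) (P (i + 1))" using Comp_Hom[OF E(2) E(1)] .
  show "is_kernel A (k i) (k (i + 1) \<cdot> e i)" by (rule ker)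
  show "is_image A (k (i + 1)) (k (i + 1) \<cdot> e i)" using is_image_comp_epi[OF S E(2,4)] .
  show "exact_pair A (k i) (k (i + 1) \<cdot> e i)"
    unfolding exact_pair_def
    using is_image_self[OF S, of i] ker[of i] Hom_Mor[OF E(1)] Hom_Mor[OF Comp_Hom[OF E(2) E(1)]]
      Hom_Cod[OF E(1)] Hom_Dom[OF Comp_Hom[OF E(2) E(1)]] by auto
  show "exact_pair A (k (i + 1) \<cdot> e i) (k (i + 1 + 1) \<cdot> e (i + 1))"
    using exact_pair_comp_epi[OF S E(2,4) ker] .
qed

section \<open>Gorenstein projective objects as terms of complete chains\<close>

lemma complete_chain_GP:
  assumes "complete_chain A Z P k e"
  shows "Z 0 \<in> GP A"
proof -
  note S = complete_chainD[OF assms]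
  note E = short_exactD[OF S(2)] and D = complete_chain_exact[OF assms]
  let ?d = "\<lambda>i. k (i + 1) \<cdot> e i"
  have "kernel (hom_group A (P (i + 1)) Q) (hom_group A (P i) Q) (precomp A (?d i)) =
      precomp A (?d (i + 1)) ` carrier (hom_group A (P (i + 2)) Q)" if "projective A Q" for Q i
  proof -
    \<comment> \<open>Exactness of Hom into \<open>Q\<close> at \<open>P (i + 1)\<close> is the
      extension property of \<open>k (i + 2)\<close>; splicing produces the index in the form
      \<open>i + 1 + 1\<close>.\<close>
    have "i + 1 + 1 = i + 2" by simp
    moreover have "\<forall>h\<in>Hom A (Z (i + 1 + 1)) Q. \<exists>g\<in>Hom A (P (i + 1 + 1)) Q. h = g \<cdot> k (i + 1 + 1)"
      using S(4)[unfolded left_proj_approx_iff[OF E(1) S(3)]] that by blast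
    moreover have "Q \<in> Obj A" using that by (simp add: projective_def)
    ultimately show ?thesis
      using cocycles_eq_coboundaries_iff[OF S(2) E(2,4) E(1), of Q i]
      by (simp add: kernel_def precomp_def add.commute)
  qed
  then have "totally_acyclic A P ?d"
    using S(3) D(1,5) unfolding totally_acyclic_def acyclic_complex_def by blast
  moreover have "is_kernel A (k 0) (?d 0)" by (rule D(2))
  moreover have "isomorphic A (Z 0) (Dom A (k 0))"
    using Hom_Obj[OF E(1)[of 0]] Hom_Dom[OF E(1)[of 0]] Id_Hom[of "Z 0"] Id_left[of "Id A (Z 0)"]
    unfolding isomorphic_def by auto
  ultimately show ?thesis unfolding GP_def by blast
qed

lemma GP_complete_chain:
  assumes "X \<in> GP A"
  obtains Z P k e where "complete_chain A Z P k e" "Z 0 = X"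
proof -
  obtain P d k0 where ta: "totally_acyclic A P d" and k0: "is_kernel A k0 (d 0)"
    and iso: "isomorphic A X (Dom A k0)" using assms by (auto simp: GP_def)
  have proj: "\<And>i. projective A (P i)" and d: "\<And>i. d i \<in> Hom A (P i) (P (i + 1))"
    and ex: "\<And>i. exact_pair A (d i) (d (i + 1))"
    using ta by (auto simp: totally_acyclic_def acyclic_complex_def)
  obtain f g where fg: "f \<in> Hom A X (Dom A k0)" "g \<in> Hom A (Dom A k0) X"
      "g \<cdot> f = Id A X" "f \<cdot> g = Id A (Dom A k0)"
    using iso by (auto simp: isomorphic_def)
  note k0H = is_kernel_Hom[OF k0 d]
  note K0 = k0[unfolded is_kernel_iff[OF d k0H]]
  note kf = Comp_Hom[OF fg(1) k0H]
  \<comment> \<open>\<open>X\<close> is only isomorphic to the cocycle object. Composing with the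
    isomorphism gives a kernel of \<open>d 0\<close> whose domain is exactly
    \<open>X\<close>.\<close>
  have "is_kernel A (k0 \<cdot> f) (d 0)"
    unfolding is_kernel_iff[OF d kf]
  proof (intro conjI allI ballI impI)
    have "u = v" if "u \<in> Hom A W X" "v \<in> Hom A W X" "(k0 \<cdot> f) \<cdot> u = (k0 \<cdot> f) \<cdot> v" for W u v
    proof -
      have "f \<cdot> u = f \<cdot> v"
        using mono_cancel[OF _ k0H Comp_Hom[OF that(1) fg(1)] Comp_Hom[OF that(2) fg(1)]] K0 that(3)
          Comp_assoc[OF that(1) fg(1) k0H] Comp_assoc[OF that(2) fg(1) k0H] by simp
      then show ?thesis
        using Comp_assoc[OF that(1) fg(1,2)] Comp_assoc[OF that(2) fg(1,2)] fg(3)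
          Id_left[OF that(1)] Id_left[OF that(2)] by simp
    qed
    then show "mono_mor A (k0 \<cdot> f)"
      using Hom_Mor[OF kf] Hom_Dom[OF kf] by (auto simp: mono_mor_def)
    show "d 0 \<cdot> (k0 \<cdot> f) = Zero A X (P (0 + 1))"
      using Comp_assoc[OF fg(1) k0H d] K0 Comp_Zero(2)[OF fg(1)] Hom_Obj[OF d, of 0] by simp
    fix W h assume "h \<in> Hom A W (P 0)" "d 0 \<cdot> h = Zero A W (P (0 + 1))"
    then obtain u where u: "u \<in> Hom A W (Dom A k0)" "h = k0 \<cdot> u" using K0 by blast
    then have "h = (k0 \<cdot> f) \<cdot> (g \<cdot> u)"
      using Comp_assoc[OF Comp_Hom[OF u(1) fg(2)] fg(1) k0H] Comp_assoc[OF u(1) fg(2,1)] fg(4)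
        Id_left[OF u(1)] by simp
    then show "\<exists>u\<in>Hom A W X. h = (k0 \<cdot> f) \<cdot> u" using Comp_Hom[OF u(1) fg(2)] by blast
  qed
  moreover have "\<forall>i. \<exists>k. is_kernel A k (d i)" using ex_kernel Hom_Mor d by blast
  then obtain k' where "\<And>i. is_kernel A (k' i) (d i)" by metis
  \<comment> \<open>Kernels are chosen in all degrees, and the one in degree 0 is overwritten by
    \<open>k0 \<cdot> f\<close>.\<close>
  ultimately obtain k where k: "\<And>i. is_kernel A (k i) (d i)" "Dom A (k 0) = X"
    using that Hom_Dom[OF kf] by (metis (full_types) fun_upd_apply)
  note kH = is_kernel_Hom[OF k(1) d]
  have "\<exists>q. q \<in> Hom A (P i) (Dom A (k (i + 1))) \<and> epi_mor A q \<and> d i = k (i + 1) \<cdot> q" for i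
    using exact_pair_factor[OF ex k(1) d] by metis
  then obtain q where q: "\<And>i. q i \<in> Hom A (P i) (Dom A (k (i + 1)))" "\<And>i. epi_mor A (q i)"
      "\<And>i. d i = k (i + 1) \<cdot> q i" by metis
  have mono: "mono_mor A (k i)" for i using k(1)[of i] is_kernel_iff[OF d kH] by blast
  have S: "short_exact A (Dom A (k i)) (P i) (Dom A (k (i + 1))) (k i) (q i)" for i
    using short_exact_kernel_factor[OF k(1) d q(3) q(1,2) kH mono] .
  have "left_proj_approx A (k (i + 1 + 1))" for i
    unfolding left_proj_approx_iff[OF kH proj]
  proof (intro allI impI)
    fix Q assume Q: "projective A Q"
    have "i + 1 + 1 = i + 2" by simp
    moreover have "kernel (hom_group A (P (i + 1)) Q) (hom_group A (P i) Q) (precomp A (d i)) =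
        precomp A (d (i + 1)) ` carrier (hom_group A (P (i + 2)) Q)"
      using ta Q by (simp add: totally_acyclic_def)
    moreover have "Q \<in> Obj A" using Q by (simp add: projective_def)
    ultimately show "\<forall>h\<in>Hom A (Dom A (k (i + 1 + 1))) Q. \<exists>g\<in>Hom A (P (i + 1 + 1)) Q.
        h = g \<cdot> k (i + 1 + 1)"
      using cocycles_eq_coboundaries_iff[OF S q(1,2) kH, of Q i] q(3)[of i] q(3)[of "i + 1"]
      by (simp add: kernel_def precomp_def add.commute)
  qed
  \<comment> \<open>The complex is unbounded, so shifting by two reaches every index.\<close>
  from this[of "i - 2" for i] have "left_proj_approx A (k i)" for i by simp
  then have "complete_chain A (\<lambda>i. Dom A (k i)) P k q"
    using S proj by (simp add: complete_chain_def proj_presentation_def)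
  then show thesis using that k(2) by blast
qed

section \<open>Torsionfree objects and complete chains\<close>

lemma complete_chain_torsionfree:
  assumes "complete_chain A Z P k e"
  shows "torsionfree A n (Z 0)"
proof -
  note S = complete_chainD[OF assms]
  note E = short_exactD[OF S(2)] and D = complete_chain_exact[OF assms]
  \<comment> \<open>The sequence starts with the inclusion of \<open>Z 0\<close>, followed by the
    spliced differentials. Its count begins at 1, so its \<open>i\<close>-th projective is
    \<open>P (int i - 1)\<close> and the image inclusion of \<open>f i\<close> is
    \<open>k (int i - 1)\<close>.\<close>
  define f where "f i = (if i = 1 then k 0 else k (int i - 2 + 1) \<cdot> e (int i - 2))" for i :: nat
  have "f (Suc i) \<in> Hom A (P (int i - 1)) (P (int (Suc i) - 1))" if "i \<in> {1..<n}" for i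
    using D(1)[of "int i - 1"] that by (simp add: f_def)
  moreover have "exact_pair A (f i) (f (Suc i))" if "i \<in> {1..<n}" for i
    using D(4)[of 0] D(5)[of "int i - 2"] that
    by (cases "i = 1") (simp_all add: f_def algebra_simps)
  moreover have "\<exists>m. is_image A m (f i) \<and> left_proj_approx A m" if "i \<in> {1..n}" for i
    using is_image_self[OF S(2), of 0] S(4) D(3)[of "int i - 2"] by (auto simp: f_def)
  ultimately show ?thesis
    unfolding torsionfree_def using S(3) E(1)[of 0] E(3)[of 0]
    by (intro exI[of _ "\<lambda>i. P (int i - 1)"] exI[of _ f]) (simp add: f_def)
qed

lemma torsionfree_1:
  assumes "torsionfree A n M" "n \<ge> 1"
  obtains P f m where "projective A P" "f \<in> Hom A M P" "mono_mor A f" "is_image A m f"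
    "left_proj_approx A m"
proof -
  obtain P f where f: "\<forall>i\<in>{1..n}. projective A (P i)" "f 1 \<in> Hom A M (P 1)" "mono_mor A (f 1)"
      "\<forall>i\<in>{1..n}. \<exists>m. is_image A m (f i) \<and> left_proj_approx A m"
    using assms(1) unfolding torsionfree_def by blast
  have "1 \<in> {1..n}" using assms(2) by simp
  then show thesis using that f by blast
qed

lemma torsionfree_imp_1:
  assumes "torsionfree A n M" "n \<ge> 1"
  shows "torsionfree A 1 M"
proof -
  obtain P f m where "projective A P" "f \<in> Hom A M P" "mono_mor A f" "is_image A m f"
      "left_proj_approx A m" using torsionfree_1[OF assms] .
  then show ?thesis
    unfolding torsionfree_def by (intro exI[of _ "\<lambda>_. P"] exI[of _ "\<lambda>_. f"]) auto
qed

text \<open>The approximation property is given for an image \<open>m\<close> of \<open>f\<close>,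
  not for \<open>f\<close>. As \<open>f\<close> is mono, it is also a kernel of its cokernel, so
  \<open>m\<close> and \<open>f\<close> factor through each other and the property passes to
  \<open>f\<close>.\<close>

lemma torsionfree_proj_presentation:
  assumes "torsionfree A 1 M"
  obtains P N k e where "proj_presentation A M P N k e" "left_proj_approx A k"
proof -
  obtain P f m where P: "projective A P" and f: "f \<in> Hom A M P" "mono_mor A f"
    and m: "is_image A m f" "left_proj_approx A m" using torsionfree_1[OF assms] by auto
  obtain c where c: "is_cokernel A c f" "is_kernel A m c" using m(1) by (auto simp: is_image_def)
  note cH = is_cokernel_Hom[OF c(1) f(1)]
  note mH = is_kernel_Hom[OF c(2) cH]
  have S: "short_exact A M P (Cod A c) f c" using short_exact_of_mono[OF f(2,1) c(1)] .
  have M: "mono_mor A m" "c \<cdot> m = Zero A (Dom A m) (Cod A c)"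
      "\<And>W h. h \<in> Hom A W P \<Longrightarrow> c \<cdot> h = Zero A W (Cod A c) \<Longrightarrow> \<exists>u\<in>Hom A W (Dom A m). h = m \<cdot> u"
    using c(2)[unfolded is_kernel_iff[OF cH mH]] by blast+
  obtain v where v: "v \<in> Hom A (Dom A m) M" "m = f \<cdot> v" using short_exactD(6)[OF S mH M(2)] by blast
  obtain u where u: "u \<in> Hom A M (Dom A m)" "f = m \<cdot> u"
    using M(3)[OF f(1) short_exactD(5)[OF S]] by blast
  have "f \<cdot> (v \<cdot> u) = f \<cdot> Id A M"
    using Comp_assoc[OF u(1) v(1) f(1)] Id_right[OF f(1)] by (simp flip: u(2) v(2))
  then have vu: "v \<cdot> u = Id A M"
    using mono_cancel[OF f(2,1) Comp_Hom[OF u(1) v(1)] Id_Hom] Hom_Obj[OF f(1)] by blast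
  have "\<exists>g\<in>Hom A P Q. h = g \<cdot> f" if Q: "projective A Q" and h: "h \<in> Hom A M Q" for Q h
  proof -
    obtain g where g: "g \<in> Hom A P Q" "h \<cdot> v = g \<cdot> m"
      using m(2)[unfolded left_proj_approx_iff[OF mH P]] Q Comp_Hom[OF v(1) h] by blast
    have "h = (h \<cdot> v) \<cdot> u" using Comp_assoc[OF u(1) v(1) h] vu Id_right[OF h] by simp
    also have "\<dots> = g \<cdot> f" using Comp_assoc[OF u(1) mH g(1)] g(2) u(2) by simp
    finally show ?thesis using g(1) by blast
  qed
  then have "left_proj_approx A f" using left_proj_approx_iff[OF f(1) P] by blast
  then show thesis using that S P unfolding proj_presentation_def by blast
qed

end

section \<open>The two inclusions between \<open>GP A\<close> and \<open>perp_proj A\<close>\<close>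

context abelian_category_enough_projectives
begin

lemma GP_subset_perp_proj: "GP A \<subseteq> perp_proj A"
proof
  fix X assume "X \<in> GP A"
  then obtain Z P k e where chain: "complete_chain A Z P k e" "Z 0 = X"
    using GP_complete_chain by blast
  \<comment> \<open>Read downwards from \<open>Z 0\<close>, the \<open>n\<close>-th presentation
    ends at \<open>Z (- int n)\<close> and therefore has index \<open>- 1 - int n\<close>.\<close>
  let ?l = "\<lambda>n. - 1 - int n"
  have "syzygy_chain A (\<lambda>n. Z (- int n)) (P \<circ> ?l) (k \<circ> ?l) (e \<circ> ?l)"
    unfolding syzygy_chain_def
  proof
    fix n
    have "- int (Suc n) = ?l n" "- int n = ?l n + 1" by simp_all
    with complete_chainD(1)[OF chain(1), of "?l n"]
    show "proj_presentation A (Z (- int (Suc n))) ((P \<circ> ?l) n) (Z (- int n)) ((k \<circ> ?l) n)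
        ((e \<circ> ?l) n)" by (simp only: comp_apply)
  qed
  from perp_proj_iff_chain[OF this] show "X \<in> perp_proj A"
    using complete_chainD(4)[OF chain(1)] chain(2) by simp
qed

lemma perp_proj_subset_GP:
  assumes "\<forall>M\<in>perp_proj A. torsionfree A 1 M"
  shows "perp_proj A \<subseteq> GP A"
proof
  fix X assume X: "X \<in> perp_proj A"
  have "\<forall>M. \<exists>N P k e. M \<in> perp_proj A \<longrightarrow>
      proj_presentation A M P N k e \<and> left_proj_approx A k \<and> N \<in> perp_proj A"
    using torsionfree_proj_presentation assms perp_proj_syzygy_iff by metis
  \<comment> \<open>By dimension shifting, a kernel in the class whose inclusion is an approximation
    forces the cokernel into the class, so the step upwards can be repeated.\<close>
  then obtain N P k e where up: "\<And>M. M \<in> perp_proj A \<Longrightarrow>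
      proj_presentation A M (P M) (N M) (k M) (e M) \<and> left_proj_approx A (k M) \<and> N M \<in> perp_proj A"
    by metis
  have "M \<in> Obj A" if "M \<in> perp_proj A" for M using that by (simp add: perp_proj_def)
  then have "\<forall>M. \<exists>K P k e. M \<in> perp_proj A \<longrightarrow>
      proj_presentation A K P M k e \<and> left_proj_approx A k \<and> K \<in> perp_proj A"
    using ex_proj_presentation perp_proj_syzygy_iff by metis
  then obtain K P' k' e' where down: "\<And>M. M \<in> perp_proj A \<Longrightarrow>
      proj_presentation A (K M) (P' M) M (k' M) (e' M) \<and> left_proj_approx A (k' M) \<and>
      K M \<in> perp_proj A"
    by metis
  \<comment> \<open>Cokernels are iterated upwards and syzygies downwards; both halves meet at
    \<open>X\<close> in degree 0.\<close>
  define Z where "Z i = (if i \<ge> 0 then (N ^^ nat i) X else (K ^^ nat (- i)) X)" for i :: int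
  have "(N ^^ n) X \<in> perp_proj A" "(K ^^ n) X \<in> perp_proj A" for n
    using X up down by (induction n) auto
  then have Z_perp: "Z i \<in> perp_proj A" for i by (simp add: Z_def)
  have Z_up: "Z (i + 1) = N (Z i)" if "i \<ge> 0" for i
    using that by (simp add: Z_def nat_add_distrib)
  have Z_down: "Z i = K (Z (i + 1))" if "i < 0" for i
  proof -
    have "nat (- i) = Suc (nat (- (i + 1)))" using that by simp
    moreover have "Z (i + 1) = (K ^^ nat (- (i + 1))) X" using that by (simp add: Z_def)
    ultimately show ?thesis using that by (simp add: Z_def)
  qed
  \<comment> \<open>For \<open>i \<ge> 0\<close> the presentation at \<open>i\<close> is the one
    chosen for its kernel \<open>Z i\<close>; for negative \<open>i\<close> it is the one chosen for
    its cokernel \<open>Z (i + 1)\<close>.\<close>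
  let ?join = "\<lambda>(u :: 'a \<Rightarrow> _) v i. if i \<ge> 0 then u (Z i) else v (Z (i + 1))"
  have "complete_chain A Z (?join P P') (?join k k') (?join e e')"
    unfolding complete_chain_def
  proof
    fix i :: int
    show "proj_presentation A (Z i) (?join P P' i) (Z (i + 1)) (?join k k' i) (?join e e' i) \<and>
        left_proj_approx A (?join k k' i)"
      using up[OF Z_perp, of i] down[OF Z_perp, of "i + 1"] Z_up[of i] Z_down[of i] by auto
  qed
  then show "X \<in> GP A" using complete_chain_GP by (force simp: Z_def)
qed

end

section \<open>The cycle of implications through the four conditions\<close>

theorem proposition4p2:
  fixes A :: "('o, 'm, 'x) ab_category_scheme"
  assumes "abelian_category A"
    and "enough_projectives A"
  shows "(weakly_Gorenstein A \<longleftrightarrow> (\<forall>M\<in>perp_proj A. infinitely_torsionfree A M)) \<and>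
    ((\<forall>M\<in>perp_proj A. infinitely_torsionfree A M) \<longleftrightarrow>
      (\<exists>n\<ge>1. \<forall>M\<in>perp_proj A. torsionfree A n M)) \<and>
    ((\<exists>n\<ge>1. \<forall>M\<in>perp_proj A. torsionfree A n M) \<longleftrightarrow> (\<forall>M\<in>perp_proj A. torsionfree A 1 M))"
proof -
  interpret abelian_category_enough_projectives A
    using assms
    by (simp add: abelian_category_enough_projectives_def abelian_category_enough_projectives_axioms_def)
  \<comment> \<open>Moving an object of \<open>GP A\<close> to position 0 of a complete chain, the
    half to its right gives the required sequences of every length. This is the first arrow of the
    cycle.\<close>
  have "infinitely_torsionfree A M" if "M \<in> GP A" for M
    using GP_complete_chain[OF that] complete_chain_torsionfree
    unfolding infinitely_torsionfree_def by metis
  then have "weakly_Gorenstein A \<Longrightarrow> \<forall>M\<in>perp_proj A. infinitely_torsionfree A M"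
    by (simp add: weakly_Gorenstein_def)
  moreover have "\<forall>M\<in>perp_proj A. infinitely_torsionfree A M \<Longrightarrow>
      \<exists>n\<ge>1. \<forall>M\<in>perp_proj A. torsionfree A n M"
    by (auto simp: infinitely_torsionfree_def)
  moreover have "\<exists>n\<ge>1. \<forall>M\<in>perp_proj A. torsionfree A n M \<Longrightarrow>
      \<forall>M\<in>perp_proj A. torsionfree A 1 M"
    using torsionfree_imp_1 by blast
  moreover have "\<forall>M\<in>perp_proj A. torsionfree A 1 M \<Longrightarrow> weakly_Gorenstein A"
    using GP_subset_perp_proj perp_proj_subset_GP by (auto simp: weakly_Gorenstein_def)
  ultimately show ?thesis by blast
qed

end
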